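(* Let $E$ be a compact metric space with Borel $\sigma$-field $\mathcal{A}$, $T:E\to E$ continuous, $\mu$ a $T$-invariant Borel probability measure such that $S=(E,\mathcal{A},\mu,T)$ is uniquely ergodic, $f:E\to[0,1]$ continuous with $\int_Ef\,d\mu=\frac12$ and $a=\int_E4f(1-f)\,d\mu>0$, $x\in E$, and $J>0$. Assume that $f\in\mathcal{C}_{1/2}(S)$, i.e. for every $y\in E$, $\big|\sum_{k=1}^n\big(f(T^ky)-\int_Ef\,d\mu\big)\big|=o(\sqrt n)$ as $n\to\infty$. Then for every $0<\beta<\beta_c$ (with $\beta_c$, $\mathbb{Q}_{n,x}$, $M_n$ as in the context), the distribution of $M_n$ under $\mathbb{Q}_{n,x}$ satisfies, as $n\to\infty$, the law of large numbers $$\frac1nM_n\Rightarrow\delta_0$$ and the central limit theorem $$\frac1{\sqrt n}M_n\Rightarrow\mathcal{N}(0,\sigma^2),\qquad\sigma^2=\frac{a}{1-\beta Ja},$$ where $\Rightarrow$ denotes convergence in distribution.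
   Context: Uniquely ergodic: $\mu$ is the only $T$-invariant Borel probability measure on $E$. Gibbs measure: for $n\ge1$, $\mathbb{Q}_{n,x}$ (depending on $\beta,J,f$) is the probability measure on $\{-1,+1\}^n$ giving $\sigma=(\sigma_1,\dots,\sigma_n)$ a mass proportional to $$\exp\Big(\frac{\beta J}{2n}\Big(\sum_{i=1}^n\sigma_i\Big)^2\Big)\prod_{i=1}^n p_i(\sigma_i),\qquad p_i(1)=f(T^ix),\ p_i(-1)=1-f(T^ix).$$ When $f$ takes values in $(0,1)$ this is the measure proportional to $\exp[H_{n,x}(\sigma)]$ with $H_{n,x}(\sigma)=\frac{\beta J}{2n}(\sum_i\sigma_i)^2+\frac12\sum_{i}\log\big(\frac{f(T^ix)}{1-f(T^ix)}\big)\sigma_i$. The magnetization is $M_n=\sum_{i=1}^n\sigma_i$. Critical inverse temperature: $\beta_c=\sup\{\beta>0: G_\beta(s)\ge0\ \forall s\in\mathbb{R}\}$, where $G_\beta(s)=\frac{\beta J}{2}s^2-\int_E\log\big(f(y)e^{\beta Js}+(1-f(y))e^{-\beta Js}\big)\,d\mu(y)$. *)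

theory Defs
  imports "HOL-Probability.Probability" "HOL-Library.Landau_Symbols"
begin

definition invariant_prob :: "('e::topological_space \<Rightarrow> 'e) \<Rightarrow> 'e measure \<Rightarrow> bool" where
  "invariant_prob T \<nu> \<longleftrightarrow>
     prob_space \<nu> \<and> sets \<nu> = sets borel \<and> T \<in> measurable \<nu> \<nu> \<and> distr \<nu> \<nu> T = \<nu>"

definition uniquely_ergodic :: "('e::topological_space \<Rightarrow> 'e) \<Rightarrow> 'e measure \<Rightarrow> bool" where
  "uniquely_ergodic T \<mu> \<longleftrightarrow>
     invariant_prob T \<mu> \<and> (\<forall>\<nu>. invariant_prob T \<nu> \<longrightarrow> \<nu> = \<mu>)"

definition C_half :: "('e \<Rightarrow> 'e) \<Rightarrow> 'e measure \<Rightarrow> ('e \<Rightarrow> real) set" where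
  "C_half T \<mu> =
     {f. \<forall>y. (\<lambda>n::nat. \<bar>\<Sum>k=1..n. (f ((T ^^ k) y) - (\<integral>z. f z \<partial>\<mu>))\<bar>) \<in> o(\<lambda>n. sqrt (real n))}"

text \<open>Elements of the configuration space are the spin vectors indexed by 1, ..., n;
  they are extensional, so that the set is finite and has \<open>2 ^ n\<close> elements.\<close>

definition configs :: "nat \<Rightarrow> (nat \<Rightarrow> real) set" where
  "configs n = ({1..n} \<rightarrow>\<^sub>E {-1, 1})"

definition magnetization :: "nat \<Rightarrow> (nat \<Rightarrow> real) \<Rightarrow> real" where
  "magnetization n \<sigma> = (\<Sum>i=1..n. \<sigma> i)"

definition site_prob :: "('e \<Rightarrow> 'e) \<Rightarrow> ('e \<Rightarrow> real) \<Rightarrow> 'e \<Rightarrow> nat \<Rightarrow> real \<Rightarrow> real" where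
  "site_prob T f x i s = (if s = 1 then f ((T ^^ i) x) else 1 - f ((T ^^ i) x))"

definition gibbs_weight ::
  "real \<Rightarrow> real \<Rightarrow> ('e \<Rightarrow> 'e) \<Rightarrow> ('e \<Rightarrow> real) \<Rightarrow> nat \<Rightarrow> 'e \<Rightarrow> (nat \<Rightarrow> real) \<Rightarrow> real" where
  "gibbs_weight \<beta> J T f n x \<sigma> =
     exp (\<beta> * J / (2 * real n) * (\<Sum>i=1..n. \<sigma> i)\<^sup>2) * (\<Prod>i=1..n. site_prob T f x i (\<sigma> i))"

text \<open>The normalizing sum is positive whenever \<open>f\<close> takes values in \<open>{0..1}\<close>, because
  the products of the site probabilities already sum to 1 over all configurations.\<close>

definition gibbs_measure ::
  "real \<Rightarrow> real \<Rightarrow> ('e \<Rightarrow> 'e) \<Rightarrow> ('e \<Rightarrow> real) \<Rightarrow> nat \<Rightarrow> 'e \<Rightarrow> (nat \<Rightarrow> real) measure" where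
  "gibbs_measure \<beta> J T f n x =
     point_measure (configs n)
       (\<lambda>\<sigma>. ennreal (gibbs_weight \<beta> J T f n x \<sigma> / (\<Sum>\<tau>\<in>configs n. gibbs_weight \<beta> J T f n x \<tau>)))"

definition free_energy_G :: "real \<Rightarrow> 'e measure \<Rightarrow> ('e \<Rightarrow> real) \<Rightarrow> real \<Rightarrow> real \<Rightarrow> real" where
  "free_energy_G J \<mu> f \<beta> s =
     \<beta> * J / 2 * s\<^sup>2
       - (\<integral>y. ln (f y * exp (\<beta> * J * s) + (1 - f y) * exp (- (\<beta> * J * s))) \<partial>\<mu>)"

text \<open>This is a supremum in the reals. If \<open>J > 0\<close>, \<open>f\<close> has mean 1/2 and
  \<open>a = \<integral> 4 f (1 - f) d\<mu> > 0\<close>, the set is nonempty (Hoeffding's lemma shows that it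
  contains \<open>1 / J\<close>) and bounded above by \<open>1 / (J a)\<close> (second derivative at 0), so the
  value is the usual supremum.\<close>

definition beta_c :: "real \<Rightarrow> 'e measure \<Rightarrow> ('e \<Rightarrow> real) \<Rightarrow> real" where
  "beta_c J \<mu> f = Sup {\<beta>. \<beta> > 0 \<and> (\<forall>s. free_energy_G J \<mu> f \<beta> s \<ge> 0)}"

text \<open>Parametrized by mean and variance, whereas \<open>normal_density\<close> takes the standard
  deviation.\<close>

definition normal_law :: "real \<Rightarrow> real \<Rightarrow> real measure" where
  "normal_law m v = density lborel (\<lambda>t. ennreal (normal_density m (sqrt v) t))"

end

(* Linearizing the quadratic interaction by a Gaussian variable g (Hubbard-Stratonovich) turns the
   unnormalized characteristic function of M_n / sqrt n under the Gibbs measure into the Gaussian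
   integral of prod_i E exp (sigma_i (sqrt (beta J) g + i t) / sqrt n) over independent spins.
   The drift vanishes because f is in C_1/2, and unique ergodicity makes the variances average to a,
   so the product converges to exp (a (sqrt (beta J) g + i t)^2 / 2). For beta < beta_c the condition
   G >= 0, transferred to orbit averages by unique ergodicity, gives an integrable Gaussian
   dominating function, and dominated convergence with Levy's continuity theorem concludes. Letting
   t vary with n yields the law of large numbers from the same limit.

   Orbit averages converge by compactness: coding E injectively into [0,1] with uniformly continuous
   inverse lets Helly's theorem on the line produce weak limits of measures on E. *)

theory Submission
  imports Defs
begin

text \<open>A compact space such as a sphere has no continuous injection into the line, so the code
  is only Borel. Two consequences follow. Limit laws of codes may charge points of the closure of
  its range that code nothing, so decoding has to be extended to that closure; and test functions
  are transported through the decoding map, whose continuity is what the coding is designed for.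

  The delicate estimate is the Gaussian domination. Unique ergodicity gives convergence of orbit
  averages of cumulant functions for each fixed argument \<open>u\<close>, but the integrand
  evaluates them at \<open>u\<close> = sqrt (beta J) g / sqrt n and multiplies by n. A bound by a
  multiple of u^2 is therefore needed for all real \<open>u\<close> simultaneously, including the
  region near 0 where an additive error is useless. The spins are centred first so that these
  functions have no linear term; the removed linear terms form the drift. The strict inequality beta
  < \<open>beta_c\<close> supplies the slack that pays for every error made in passing from the
  integral to the averages.\<close>

section \<open>Averages along orbits of uniquely ergodic maps\<close>

text \<open>At the first disagreement the ternary terms differ by twice the largest possible
  contribution of all later digits, so they cannot cancel. With binary digits the two would be
  equal, which is why the digits are 0 and 2 in base 3.\<close>

lemma cantor_code_separates:
  fixes A B :: "nat \<Rightarrow> bool"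
  assumes "\<bar>(\<Sum>j. 2 * of_bool (A j) / 3 ^ Suc j) - (\<Sum>j. 2 * of_bool (B j) / 3 ^ Suc j)\<bar> < (1 / 3 ^ N :: real)"
    and "j < N"
  shows "A j \<longleftrightarrow> B j"
proof (rule ccontr)
  assume ne: "\<not> (A j \<longleftrightarrow> B j)"
  \<comment> \<open>Taking the least disagreement makes all earlier terms of the difference
    vanish.\<close>
  define m where "m = (LEAST j. \<not> (A j \<longleftrightarrow> B j))"
  have m: "\<not> (A m \<longleftrightarrow> B m)" unfolding m_def by (rule LeastI[of _ j]) (use ne in simp)
  have less: "A i \<longleftrightarrow> B i" if "i < m" for i
    using not_less_Least[of i "\<lambda>j. \<not> (A j \<longleftrightarrow> B j)"] that unfolding m_def by blast
  have "m \<le> j" unfolding m_def by (rule Least_le) (use ne in simp)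
  hence mN: "Suc m \<le> N" using assms(2) by simp
  define d :: "nat \<Rightarrow> real" where "d i = 2 * of_bool (A i) / 3 ^ Suc i - 2 * of_bool (B i) / 3 ^ Suc i" for i
  have geo: "(\<lambda>i. 2 / 3 ^ Suc (i + k) :: real) sums (1 / 3 ^ k)" for k
  proof -
    have "(\<lambda>i. (2 / 3 ^ Suc k) * (1/3) ^ i :: real) sums ((2 / 3 ^ Suc k) * (1 / (1 - 1/3)))"
      by (intro sums_mult geometric_sums) simp
    thus ?thesis by (simp add: power_add power_divide field_simps)
  qed
  have sm: "summable (\<lambda>j. 2 * of_bool (C j) / 3 ^ Suc j :: real)" for C :: "nat \<Rightarrow> bool"
    by (rule summable_comparison_test[OF _ sums_summable[OF geo[of 0]]])
       (auto intro!: exI[of _ 0] simp: divide_simps)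
  have sd: "summable d" unfolding d_def by (intro summable_diff sm)
  have dle: "norm (d i) \<le> 2 / 3 ^ Suc i" for i by (auto simp: d_def divide_simps)
  have "(\<Sum>i. d i) = (\<Sum>i. d (i + Suc m)) + (\<Sum>i<Suc m. d i)"
    by (rule suminf_split_initial_segment[OF sd])
  also have "(\<Sum>i<Suc m. d i) = d m"
    using less by (simp add: d_def)
  finally have eq: "(\<Sum>i. d i) = (\<Sum>i. d (i + Suc m)) + d m" .
  have "norm (\<Sum>i. d (i + Suc m)) \<le> (\<Sum>i. 2 / 3 ^ Suc (i + Suc m))"
    by (intro norm_suminf_le dle sums_summable[OF geo])
  also have "\<dots> = 1 / 3 ^ Suc m" by (rule sums_unique[OF geo, symmetric])
  finally have tail: "\<bar>\<Sum>i. d (i + Suc m)\<bar> \<le> 1 / 3 ^ Suc m" by simp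
  have dm: "\<bar>d m\<bar> = 2 / 3 ^ Suc m" using m by (auto simp: d_def)
  have "1 / 3 ^ Suc m \<le> \<bar>\<Sum>i. d i\<bar>" using eq tail dm by (simp add: abs_if split: if_splits)
  moreover have "(\<Sum>i. d i) = (\<Sum>j. 2 * of_bool (A j) / 3 ^ Suc j) - (\<Sum>j. 2 * of_bool (B j) / 3 ^ Suc j)"
    unfolding d_def by (rule suminf_diff[OF sm sm, symmetric])
  moreover have "1 / 3 ^ N \<le> (1 / 3 ^ Suc m :: real)"
    using mN by (intro divide_left_mono power_increasing) auto
  ultimately show False using assms(1) by linarith
qed

text \<open>The \<open>j\<close>-th ternary digit of the code of \<open>y\<close> tells whether \<open>y\<close> lies in the \<open>j\<close>-th of
  countably many balls containing finite covers by arbitrarily small ones, so close codes force a common small ball.\<close>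

lemma compact_metric_code:
  assumes "compact (UNIV :: 'e::metric_space set)"
  obtains \<iota> :: "'e::metric_space \<Rightarrow> real" where "\<iota> \<in> borel_measurable borel" "range \<iota> \<subseteq> {0..1}"
    "\<And>\<epsilon>. \<epsilon> > 0 \<Longrightarrow> \<exists>\<delta>>0. \<forall>y z. \<bar>\<iota> y - \<iota> z\<bar> < \<delta> \<longrightarrow> dist y z < \<epsilon>"
proof -
  have "\<exists>C. finite C \<and> (UNIV :: 'e set) \<subseteq> (\<Union>c\<in>C. ball c (1 / Suc n))" for n
  proof -
    obtain C where "C \<subseteq> (UNIV :: 'e set)" "finite C" "UNIV \<subseteq> (\<Union>c\<in>C. ball c (1 / Suc n))"
      by (rule compactE_image[OF assms, of UNIV "\<lambda>c. ball c (1 / Suc n)"]) auto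
    thus ?thesis by blast
  qed
  then obtain C where C: "\<And>n. finite (C n)" "\<And>n. (UNIV :: 'e set) \<subseteq> (\<Union>c\<in>C n. ball c (1 / Suc n))"
    by metis
  define P where "P = (SIGMA n:UNIV. C n)"
  have cP: "countable P" unfolding P_def using C(1) by (intro countable_SIGMA) (auto intro: countable_finite)
  have Pne: "P \<noteq> {}" using C(2)[of 0] unfolding P_def by fastforce
  define b where "b = from_nat_into P"
  define U where "U j = ball (snd (b j)) (1 / Suc (fst (b j)))" for j
  define \<iota> :: "'e \<Rightarrow> real" where "\<iota> y = (\<Sum>j. 2 * of_bool (y \<in> U j) / 3 ^ Suc j)" for y
  have geo: "(\<lambda>i. 2 / 3 ^ Suc i :: real) sums 1"
  proof -
    have "(\<lambda>i. (2 / 3) * (1/3) ^ i :: real) sums ((2 / 3) * (1 / (1 - 1/3)))"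
      by (intro sums_mult geometric_sums) simp
    thus ?thesis by (simp add: power_divide field_simps)
  qed
  have sm: "summable (\<lambda>j. 2 * of_bool (y \<in> U j) / 3 ^ Suc j :: real)" for y
    by (rule summable_comparison_test[OF _ sums_summable[OF geo]])
       (auto intro!: exI[of _ 0] simp: divide_simps)
  show ?thesis
  proof
    have eq: "\<iota> = (\<lambda>y. \<Sum>j. 2 * indicator (U j) y / 3 ^ Suc j)"
      by (intro ext) (simp add: \<iota>_def indicator_def)
    have [measurable]: "U j \<in> sets borel" for j unfolding U_def by simp
    show "\<iota> \<in> borel_measurable borel" unfolding eq by measurable
    have "0 \<le> \<iota> y" "\<iota> y \<le> 1" for y
    proof -
      show "0 \<le> \<iota> y" unfolding \<iota>_def by (intro suminf_nonneg sm) auto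
      have "\<iota> y \<le> (\<Sum>j. 2 / 3 ^ Suc j)" unfolding \<iota>_def
        by (intro suminf_le sm sums_summable[OF geo]) auto
      thus "\<iota> y \<le> 1" using sums_unique[OF geo] by simp
    qed
    thus "range \<iota> \<subseteq> {0..1}" by auto
    fix \<epsilon> :: real assume "\<epsilon> > 0"
    then obtain n where n: "1 / Suc n < \<epsilon> / 2" using nat_approx_posE[of "\<epsilon>/2"] by auto
    have "\<forall>c\<in>C n. \<exists>j. b j = (n, c)"
    proof
      fix c assume "c \<in> C n"
      hence "(n, c) \<in> P" by (simp add: P_def)
      thus "\<exists>j. b j = (n, c)" unfolding b_def using from_nat_into_surj[OF cP] by metis
    qed
    then obtain h where h: "\<And>c. c \<in> C n \<Longrightarrow> b (h c) = (n, c)" by metis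
    \<comment> \<open>\<open>N\<close> exceeds the index of every ball of the cover with radius 1 /
      (n+1), so codes closer than 3^-N agree on membership in all of them.\<close>
    define N where "N = Suc (Max (h ` C n))"
    have hN: "h c < N" if "c \<in> C n" for c
      unfolding N_def using that C(1)[of n] by (simp add: less_Suc_eq_le)
    show "\<exists>\<delta>>0. \<forall>y z. \<bar>\<iota> y - \<iota> z\<bar> < \<delta> \<longrightarrow> dist y z < \<epsilon>"
    proof (intro exI[of _ "1 / 3 ^ N"] conjI allI impI)
      show "0 < (1 / 3 ^ N :: real)" by simp
      fix y z assume close: "\<bar>\<iota> y - \<iota> z\<bar> < 1 / 3 ^ N"
      obtain c where c: "c \<in> C n" "y \<in> ball c (1 / Suc n)" using C(2)[of n] by blast
      have Uh: "U (h c) = ball c (1 / Suc n)" using h[OF c(1)] by (simp add: U_def)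
      have "z \<in> U (h c)"
        using cantor_code_separates[OF close[unfolded \<iota>_def] hN[OF c(1)]] c(2) Uh by simp
      hence "dist y z < 1 / Suc n + 1 / Suc n" using c(2) Uh
        by (metis add_strict_mono dist_commute dist_triangle_less_add mem_ball)
      thus "dist y z < \<epsilon>" using n by linarith
    qed
  qed
qed

text \<open>The truncations max 0 (1 - n * dist) decrease to the indicator of a closed set, and the
  closed sets form an intersection-stable generator of the Borel sets.\<close>

lemma borel_measure_eqI_continuous:
  fixes M N :: "'e::metric_space measure"
  assumes M: "prob_space M" "sets M = sets borel" and N: "prob_space N" "sets N = sets borel"
    and eq: "\<And>\<phi> :: 'e \<Rightarrow> real. continuous_on UNIV \<phi> \<Longrightarrow> (\<And>y. \<phi> y \<in> {0..1}) \<Longrightarrow>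
               integral\<^sup>L M \<phi> = integral\<^sup>L N \<phi>"
  shows "M = N"
proof -
  interpret M: prob_space M by fact
  interpret N: prob_space N by fact
  have lim: "(\<lambda>n. integral\<^sup>L K (\<lambda>y. max 0 (1 - real n * infdist y F))) \<longlonglongrightarrow> measure K F"
    if K: "prob_space K" "sets K = sets borel" and F: "closed F" "F \<noteq> {}" for K and F :: "'e set"
  proof -
    interpret K: prob_space K by fact
    have [measurable]: "(\<lambda>y. infdist y F) \<in> borel_measurable K"
      by (subst measurable_cong_sets[OF K(2) refl])
         (intro borel_measurable_continuous_onI continuous_on_infdist continuous_on_id)
    have FK[measurable]: "F \<in> sets K" unfolding K(2) using F(1) by (rule borel_closed)
    have sp: "space K = UNIV" using sets_eq_imp_space_eq[OF K(2)] by (simp only: space_borel)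
    have "(\<lambda>n. integral\<^sup>L K (\<lambda>y. max 0 (1 - real n * infdist y F))) \<longlonglongrightarrow> integral\<^sup>L K (indicator F)"
    proof (rule integral_dominated_convergence[where w = "\<lambda>_. 1"])
      show "AE y in K. (\<lambda>n. max 0 (1 - real n * infdist y F)) \<longlonglongrightarrow> indicator F y"
      proof (rule AE_I2)
        fix y
        show "(\<lambda>n. max 0 (1 - real n * infdist y F)) \<longlonglongrightarrow> indicator F y"
        proof (cases "y \<in> F")
          case True
          thus ?thesis by simp
        next
          case False
          hence pos: "infdist y F > 0" using F infdist_pos_not_in_closed by blast
          have "\<forall>\<^sub>F n in sequentially. max 0 (1 - real n * infdist y F) = 0"
            using eventually_gt_at_top[of "nat \<lceil>1 / infdist y F\<rceil>"]
          proof eventually_elim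
            case (elim n)
            hence "1 / infdist y F < real n" by linarith
            thus ?case using pos by (simp add: field_simps)
          qed
          thus ?thesis using False by (simp add: tendsto_eventually)
        qed
      qed
    next
      fix n
      show "AE y in K. norm (max 0 (1 - real n * infdist y F)) \<le> 1"
        by (intro AE_I2) (simp add: infdist_nonneg)
      show "(\<lambda>y. max 0 (1 - real n * infdist y F)) \<in> borel_measurable K" by measurable
    next
      show "(indicator F :: _ \<Rightarrow> real) \<in> borel_measurable K" by measurable
    qed simp
    thus ?thesis by (simp add: sp)
  qed
  show ?thesis
  proof (rule measure_eqI_generator_eq[where \<Omega> = UNIV and E = "Collect closed" and A = "\<lambda>_. UNIV"])
    show "Int_stable (Collect closed :: 'e set set)" by (auto simp: Int_stable_def)
    fix F :: "'e set" assume F: "F \<in> Collect closed"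
    have "measure M F = measure N F"
    \<comment> \<open>\<open>infdist\<close> to the empty set is 0 by convention, so there the
      approximating functions would be constantly 1; the empty set is treated apart.\<close>
    proof (cases "F = {}")
      case False
      have "integral\<^sup>L M (\<lambda>y. max 0 (1 - real n * infdist y F)) =
            integral\<^sup>L N (\<lambda>y. max 0 (1 - real n * infdist y F))" for n
        by (intro eq continuous_intros) (auto simp: infdist_nonneg)
      thus ?thesis using lim[OF M _ False] lim[OF N _ False] F LIMSEQ_unique by auto
    qed auto
    thus "emeasure M F = emeasure N F" by (simp add: M.emeasure_eq_measure N.emeasure_eq_measure)
  qed (use M N in \<open>auto simp: borel_eq_closed\<close>)
qed

text \<open>Sequential weak compactness. The laws of the codes all live on [0,1] and are therefore
  tight; a weak limit of them is carried by the closure of the set of codes and is mapped back to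
  the space by the decoding map.\<close>

lemma compact_metric_prob_subsequence:
  fixes M :: "nat \<Rightarrow> 'e::metric_space measure"
  assumes E: "compact (UNIV :: 'e set)"
    and M: "\<And>n. prob_space (M n)" "\<And>n. sets (M n) = sets borel"
  obtains r N where "strict_mono (r :: nat \<Rightarrow> nat)" "prob_space N" "sets N = sets borel"
    "\<And>\<phi> :: 'e \<Rightarrow> real. continuous_on UNIV \<phi> \<Longrightarrow> (\<lambda>k. integral\<^sup>L (M (r k)) \<phi>) \<longlonglongrightarrow> integral\<^sup>L N \<phi>"
proof -
  obtain \<iota> :: "'e \<Rightarrow> real" where \<iota>: "\<iota> \<in> borel_measurable borel" "range \<iota> \<subseteq> {0..1}"
    and sep: "\<And>\<epsilon>. \<epsilon> > 0 \<Longrightarrow> \<exists>\<delta>>0. \<forall>y z. \<bar>\<iota> y - \<iota> z\<bar> < \<delta> \<longrightarrow> dist y z < \<epsilon>"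
    by (rule compact_metric_code[OF E]) blast
  define K where "K = closure (range \<iota>)"
  have K: "closed K" "K \<noteq> {}" by (auto simp: K_def)
  \<comment> \<open>A decoding of \<open>t\<close> is a limit point of points whose codes tend to
    \<open>t\<close>; compactness of the space provides one. Asking for a single \<open>z\<close>
    close in both senses keeps the code and the decoding linked.\<close>
  have "\<exists>y. \<forall>\<delta>>0. \<exists>z. \<bar>\<iota> z - t\<bar> < \<delta> \<and> dist z y < \<delta>" if "t \<in> K" for t
  proof -
    have "\<exists>s. (\<forall>n. s n \<in> range \<iota>) \<and> s \<longlonglongrightarrow> t"
      using that by (simp only: K_def closure_sequential)
    then obtain s where s: "\<And>n. s n \<in> range \<iota>" "s \<longlonglongrightarrow> t" by blast
    have "\<forall>n. \<exists>z. s n = \<iota> z" using s(1) by (simp add: image_iff)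
    from choice[OF this] obtain z where z: "\<And>n. s n = \<iota> (z n)" by blast
    obtain y q where q: "strict_mono (q :: nat \<Rightarrow> nat)" "(z \<circ> q) \<longlonglongrightarrow> y"
      using E[unfolded compact_def, rule_format, of z] by auto
    have sq: "(s \<circ> q) \<longlonglongrightarrow> t" using LIMSEQ_subseq_LIMSEQ[OF s(2) q(1)] .
    show ?thesis
    proof (rule exI[of _ y], intro allI impI)
      fix \<delta> :: real assume "\<delta> > 0"
      have "\<forall>\<^sub>F n in sequentially. dist ((s \<circ> q) n) t < \<delta> \<and> dist ((z \<circ> q) n) y < \<delta>"
        by (intro eventually_conj tendstoD[OF sq] tendstoD[OF q(2)] \<open>\<delta> > 0\<close>)
      then obtain n where "dist ((s \<circ> q) n) t < \<delta> \<and> dist ((z \<circ> q) n) y < \<delta>"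
        using eventually_happens by fastforce
      thus "\<exists>z. \<bar>\<iota> z - t\<bar> < \<delta> \<and> dist z y < \<delta>"
        by (intro exI[of _ "z (q n)"]) (simp add: z dist_real_def)
    qed
  qed
  then obtain \<pi> where \<pi>: "\<And>t \<delta>. t \<in> K \<Longrightarrow> \<delta> > 0 \<Longrightarrow> \<exists>z. \<bar>\<iota> z - t\<bar> < \<delta> \<and> dist z (\<pi> t) < \<delta>"
    by metis
  have \<pi>\<iota>: "\<pi> (\<iota> y) = y" for y
  proof (rule ccontr)
    assume "\<pi> (\<iota> y) \<noteq> y"
    define e where "e = dist (\<pi> (\<iota> y)) y / 2"
    have "e > 0" using \<open>\<pi> (\<iota> y) \<noteq> y\<close> by (simp add: e_def)
    obtain d where d: "d > 0" "\<And>y z. \<bar>\<iota> y - \<iota> z\<bar> < d \<Longrightarrow> dist y z < e" using sep[OF \<open>e > 0\<close>] by blast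
    have "\<iota> y \<in> K" by (simp add: K_def closure_subset[THEN subsetD])
    then obtain z where "\<bar>\<iota> z - \<iota> y\<bar> < min d e" "dist z (\<pi> (\<iota> y)) < min d e"
      using \<pi>[of "\<iota> y" "min d e"] d(1) \<open>e > 0\<close> by auto
    hence "dist z y < e" "dist z (\<pi> (\<iota> y)) < e" using d(2) by auto
    hence "dist (\<pi> (\<iota> y)) y < 2 * e" using dist_triangle3[of "\<pi> (\<iota> y)" y z] by linarith
    thus False by (simp add: e_def)
  qed
  have \<pi>cont: "continuous_on K \<pi>"
  proof (rule uniformly_continuous_imp_continuous, unfold uniformly_continuous_on_def, intro allI impI)
    fix e :: real assume "e > 0"
    hence "e / 3 > 0" by simp
    from sep[OF this] obtain d where d: "d > 0" "\<And>y z. \<bar>\<iota> y - \<iota> z\<bar> < d \<Longrightarrow> dist y z < e / 3" by blast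
    show "\<exists>d>0. \<forall>t\<in>K. \<forall>t'\<in>K. dist t' t < d \<longrightarrow> dist (\<pi> t') (\<pi> t) < e"
    proof (intro exI[of _ "d / 3"] conjI ballI impI)
      fix t t' assume t: "t \<in> K" "t' \<in> K" "dist t' t < d / 3"
      \<comment> \<open>Replacing \<open>t\<close> and \<open>t'\<close> by genuine codes costs d/3
        each, which with their own distance stays below \<open>d\<close>; the three distances in the
        space are below e/3 each.\<close>
      have pos: "min (d / 3) (e / 3) > 0" using d(1) \<open>e > 0\<close> by simp
      obtain z where z: "\<bar>\<iota> z - t\<bar> < d / 3" "dist z (\<pi> t) < e / 3" using \<pi>[OF t(1) pos] by auto
      obtain z' where z': "\<bar>\<iota> z' - t'\<bar> < d / 3" "dist z' (\<pi> t') < e / 3" using \<pi>[OF t(2) pos] by auto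
      have "\<bar>\<iota> z - \<iota> z'\<bar> < d" using z(1) z'(1) t(3) unfolding dist_real_def by linarith
      hence "dist z z' < e / 3" by (rule d(2))
      hence "dist (\<pi> t') z < e / 3 + e / 3"
        using z'(2) dist_triangle3[of "\<pi> t'" z z'] by (simp add: dist_commute)
      thus "dist (\<pi> t') (\<pi> t) < e" using z(2) dist_triangle[of "\<pi> t'" "\<pi> t" z] by linarith
    qed (use d(1) in simp)
  qed
  \<comment> \<open>The arbitrary constant off \<open>K\<close> makes the decoding a Borel map on
    the whole line, so that \<open>L\<close> can be pushed forward along it.\<close>
  define \<pi>' where "\<pi>' t = (if t \<in> K then \<pi> t else undefined)" for t
  have \<pi>'_meas[measurable]: "\<pi>' \<in> measurable borel borel"
  proof -
    have "\<pi>' \<in> measurable borel borel \<longleftrightarrow> True"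
      unfolding \<pi>'_def using borel_measurable_continuous_on_if[of K \<pi> "\<lambda>_. undefined"] K(1) \<pi>cont
      by (auto intro: borel_closed)
    thus ?thesis by simp
  qed
  have [measurable]: "\<iota> \<in> measurable (M n) borel" for n
    using \<iota>(1) measurable_cong_sets[OF M(2) refl] by blast
  define R where "R n = distr (M n) borel \<iota>" for n
  have R: "real_distribution (R n)" for n
    unfolding R_def using M(1) by (intro prob_space.real_distribution_distr) auto
  have "tight R"
    unfolding tight_def
  proof (intro conjI allI impI R)
    fix \<epsilon> :: real assume "\<epsilon> > 0"
    \<comment> \<open>Tightness is phrased with left-open intervals, and the range bound admits the
      code 0, so the interval starts below 0.\<close>
    have "measure (R n) {-1<..1} = 1" for n
    proof -
      have "-1 < \<iota> y \<and> \<iota> y \<le> 1" for y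
        using \<iota>(2) by (auto simp: image_subset_iff intro: less_le_trans[of _ 0 "\<iota> y"])
      hence "\<iota> -` {-1<..1} \<inter> space (M n) = space (M n)" by auto
      thus ?thesis unfolding R_def using prob_space.prob_space[OF M(1)] by (subst measure_distr) auto
    qed
    thus "\<exists>a b. a < b \<and> (\<forall>n. 1 - \<epsilon> < measure (R n) {a<..b})"
      using \<open>\<epsilon> > 0\<close> by (intro exI[of _ "-1"] exI[of _ 1]) auto
  qed
  from tight_imp_convergent_subsubsequence[OF this strict_mono_id]
  obtain r L where r: "strict_mono (r :: nat \<Rightarrow> nat)" and L: "real_distribution L"
    and RL: "weak_conv_m (R \<circ> r) L" by auto
  interpret L: real_distribution L by fact
  have conv: "(\<lambda>k. integral\<^sup>L (M (r k)) (\<lambda>y. g (\<iota> y))) \<longlonglongrightarrow> integral\<^sup>L L g"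
    if g: "continuous_on UNIV g" "\<And>t. \<bar>g t\<bar> \<le> B" for g :: "real \<Rightarrow> real" and B
  proof -
    have gm[measurable]: "g \<in> borel_measurable borel" using g(1) by (rule borel_measurable_continuous_onI)
    have "(\<lambda>k. integral\<^sup>L ((R \<circ> r) k) g) \<longlonglongrightarrow> integral\<^sup>L L g"
      by (rule weak_conv_imp_integral_bdd_continuous_conv[OF _ L RL, of g B])
         (use R g in \<open>auto simp: continuous_on_eq_continuous_at\<close>)
    moreover have "integral\<^sup>L ((R \<circ> r) k) g = integral\<^sup>L (M (r k)) (\<lambda>y. g (\<iota> y))" for k
      unfolding R_def comp_def by (rule integral_distr) auto
    ultimately show ?thesis by simp
  qed
  \<comment> \<open>The truncated distance to \<open>K\<close> is a bounded continuous test function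
    that vanishes on all codes, so its integral against the limit is 0.\<close>
  have LK: "AE t in L. t \<in> K"
  proof -
    let ?g = "\<lambda>t. min 1 (infdist t K)"
    have cg: "continuous_on UNIV ?g" by (intro continuous_intros)
    have [measurable]: "?g \<in> borel_measurable borel" using cg by (rule borel_measurable_continuous_onI)
    have "\<iota> y \<in> K" for y by (simp add: K_def closure_subset[THEN subsetD])
    hence "(\<lambda>k. integral\<^sup>L (M (r k)) (\<lambda>y. ?g (\<iota> y))) = (\<lambda>_. 0)" by simp
    moreover have "(\<lambda>k. integral\<^sup>L (M (r k)) (\<lambda>y. ?g (\<iota> y))) \<longlonglongrightarrow> integral\<^sup>L L ?g"
      by (rule conv[OF cg, of 1]) (simp add: infdist_nonneg)
    ultimately have "integral\<^sup>L L ?g = 0" using LIMSEQ_unique tendsto_const by metis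
    moreover have "integrable L ?g"
      by (rule L.integrable_const_bound[of _ 1]) (auto simp: infdist_nonneg)
    ultimately have "AE t in L. ?g t = 0"
      by (subst (asm) integral_nonneg_eq_0_iff_AE) (auto simp: infdist_nonneg)
    thus ?thesis
    proof eventually_elim
      case (elim t)
      hence "infdist t K = 0" by linarith
      thus "t \<in> K" by (simp only: in_closed_iff_infdist_zero[OF K])
    qed
  qed
  define N where "N = distr L borel \<pi>'"
  show ?thesis
  proof (rule that[OF r])
    show "prob_space N" unfolding N_def by (rule L.prob_space_distr) simp
    show "sets N = sets borel" by (simp add: N_def)
    fix \<phi> :: "'e \<Rightarrow> real" assume \<phi>: "continuous_on UNIV \<phi>"
    have [measurable]: "\<phi> \<in> borel_measurable borel" using \<phi> by (rule borel_measurable_continuous_onI)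
    have "compact (range \<phi>)" using \<phi> E by (rule compact_continuous_image)
    hence "bounded (range \<phi>)" by (rule compact_imp_bounded)
    then obtain B where "B > 0" "\<forall>v\<in>range \<phi>. norm v \<le> B" by (auto simp: bounded_pos)
    hence B: "\<bar>\<phi> y\<bar> \<le> B" "0 \<le> B" for y by auto
    \<comment> \<open>The function to be integrated is defined through decoding on \<open>K\<close>
      only. Tietze's extension keeps both continuity and the bound \<open>B\<close>, as weak
      convergence on the line requires.\<close>
    have "continuous_on K (\<phi> \<circ> \<pi>)"
      using \<pi>cont \<phi> by (intro continuous_on_compose) (auto intro: continuous_on_subset)
    then obtain g where g: "continuous_on UNIV g" "\<And>t. t \<in> K \<Longrightarrow> g t = (\<phi> \<circ> \<pi>) t" "\<And>t. norm (g t) \<le> B"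
      by (rule Tietze[of K "\<phi> \<circ> \<pi>" UNIV B]) (use K B in auto)
    have [measurable]: "g \<in> borel_measurable borel" using g(1) by (rule borel_measurable_continuous_onI)
    have "\<iota> y \<in> K" for y by (simp add: K_def closure_subset[THEN subsetD])
    hence "(\<lambda>y. g (\<iota> y)) = \<phi>" using g(2) \<pi>\<iota> by (intro ext) simp
    hence "(\<lambda>k. integral\<^sup>L (M (r k)) \<phi>) \<longlonglongrightarrow> integral\<^sup>L L g"
      using conv[OF g(1), of B] g(3) by simp
    also have "integral\<^sup>L L g = integral\<^sup>L L (\<lambda>t. \<phi> (\<pi>' t))"
    proof (rule integral_cong_AE)
      show "AE t in L. g t = \<phi> (\<pi>' t)"
        using LK by eventually_elim (simp add: g(2) \<pi>'_def)
    qed measurable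
    also have "\<dots> = integral\<^sup>L N \<phi>" unfolding N_def by (rule integral_distr[symmetric]) auto
    finally show "(\<lambda>k. integral\<^sup>L (M (r k)) \<phi>) \<longlonglongrightarrow> integral\<^sup>L N \<phi>" .
  qed
qed

text \<open>The Krylov-Bogoliubov argument: if the averages stayed away from the integral along some
  times, the empirical measures of the orbit at these times would have a weak limit point. It is
  invariant, hence equal to \<mu>, which contradicts the distance.\<close>

lemma uniquely_ergodic_average:
  fixes T :: "'e::metric_space \<Rightarrow> 'e" and \<phi> :: "'e \<Rightarrow> real"
  assumes E: "compact (UNIV :: 'e set)" and T: "continuous_on UNIV T"
    and \<mu>: "uniquely_ergodic T \<mu>" and \<phi>: "continuous_on UNIV \<phi>"
  shows "(\<lambda>n. (\<Sum>i=1..n. \<phi> ((T ^^ i) x)) / real n) \<longlonglongrightarrow> integral\<^sup>L \<mu> \<phi>"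
proof (rule ccontr)
  define av where "av g n = (\<Sum>i=1..n. g ((T ^^ i) x)) / real n" for g :: "'e \<Rightarrow> real" and n
  assume "\<not> ?thesis"
  then obtain e where e: "e > 0" "\<And>n0. \<exists>n\<ge>n0. \<not> dist (av \<phi> n) (integral\<^sup>L \<mu> \<phi>) < e"
    unfolding LIMSEQ_def av_def by blast
  \<comment> \<open>Only positive times are kept, because the empirical measure is the image of the
    uniform distribution on {1..n}, which must be nonempty.\<close>
  have "infinite {n. n > 0 \<and> \<not> dist (av \<phi> n) (integral\<^sup>L \<mu> \<phi>) < e}"
    unfolding infinite_nat_iff_unbounded
  proof (intro allI)
    fix m
    obtain n where "n \<ge> Suc m" "\<not> dist (av \<phi> n) (integral\<^sup>L \<mu> \<phi>) < e" using e(2) by blast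
    thus "\<exists>n>m. n \<in> {n. n > 0 \<and> \<not> dist (av \<phi> n) (integral\<^sup>L \<mu> \<phi>) < e}"
      by (intro exI[of _ n]) auto
  qed
  from infinite_enumerate[OF this] obtain s where s: "strict_mono (s :: nat \<Rightarrow> nat)"
    "\<And>k. s k > 0" "\<And>k. \<not> dist (av \<phi> (s k)) (integral\<^sup>L \<mu> \<phi>) < e" by blast
  define M where "M k = distr (measure_pmf (pmf_of_set {1..s k})) borel (\<lambda>i. (T ^^ i) x)" for k
  have M: "prob_space (M k)" "sets (M k) = sets borel" for k
    unfolding M_def by (auto intro!: measure_pmf.prob_space_distr)
  have intM: "integral\<^sup>L (M k) g = av g (s k)" if "continuous_on UNIV g" for g :: "'e \<Rightarrow> real" and k
  proof -
    have "{1..s k} \<noteq> {}" using s(2)[of k] by (simp add: Suc_le_eq)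
    thus ?thesis unfolding M_def av_def
      using borel_measurable_continuous_onI[OF that]
      by (subst integral_distr) (auto simp: integral_pmf_of_set)
  qed
  obtain r N where r: "strict_mono (r :: nat \<Rightarrow> nat)" and N: "prob_space N" "sets N = sets borel"
    and lim: "\<And>g :: 'e \<Rightarrow> real. continuous_on UNIV g \<Longrightarrow> (\<lambda>k. integral\<^sup>L (M (r k)) g) \<longlonglongrightarrow> integral\<^sup>L N g"
    by (rule compact_metric_prob_subsequence[OF E M]) (rule that)
  interpret N: prob_space N by fact
  have lim': "(\<lambda>k. av g (s (r k))) \<longlonglongrightarrow> integral\<^sup>L N g" if "continuous_on UNIV g" for g :: "'e \<Rightarrow> real"
    using lim[OF that] intM[OF that] by simp
  have Tm[measurable]: "T \<in> measurable borel borel" using T by (rule borel_measurable_continuous_onI)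
  have TN: "T \<in> measurable N N" using Tm measurable_cong_sets[OF N(2) N(2)] by blast
  have sr: "filterlim (\<lambda>k. s (r k)) at_top sequentially"
    using filterlim_compose[OF filterlim_subseq[OF s(1)] filterlim_subseq[OF r]] .
  have "distr N N T = N"
  proof (rule borel_measure_eqI_continuous)
    show "prob_space (distr N N T)" by (rule N.prob_space_distr[OF TN])
    fix g :: "'e \<Rightarrow> real" assume g: "continuous_on UNIV g" "\<And>y. g y \<in> {0..1}"
    have gT: "continuous_on UNIV (\<lambda>y. g (T y))"
      using continuous_on_compose2[OF g(1) T] by simp
    \<comment> \<open>Composing with \<open>T\<close> shifts the orbit by one step; the sums
      telescope to two boundary values, both in [0,1]. At n = 0 both sides are 0 by the convention
      for division.\<close>
    have bound: "\<bar>av (\<lambda>y. g (T y)) n - av g n\<bar> \<le> 1 / real n" for n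
    proof -
      have "(\<Sum>i=1..n. g (T ((T ^^ i) x))) = (\<Sum>i=Suc 1..Suc n. g ((T ^^ i) x))"
        by (subst sum.shift_bounds_cl_Suc_ivl) simp
      hence "(\<Sum>i=1..n. g (T ((T ^^ i) x))) - (\<Sum>i=1..n. g ((T ^^ i) x)) = g ((T ^^ Suc n) x) - g ((T ^^ 1) x)"
        if "n > 0"
        using that by (subst (2) sum.atLeast_Suc_atMost) auto
      moreover have "\<bar>g ((T ^^ Suc n) x) - g ((T ^^ 1) x)\<bar> \<le> 1"
        using g(2)[of "(T ^^ Suc n) x"] g(2)[of "(T ^^ 1) x"] by (auto simp: abs_le_iff)
      ultimately show ?thesis
        unfolding av_def by (cases "n = 0") (auto simp: diff_divide_distrib[symmetric] intro!: divide_right_mono)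
    qed
    have "(\<lambda>k. 1 / real (s (r k))) \<longlonglongrightarrow> 0"
      using filterlim_compose[OF lim_1_over_n sr] .
    hence "(\<lambda>k. av (\<lambda>y. g (T y)) (s (r k)) - av g (s (r k))) \<longlonglongrightarrow> 0"
      by (rule Lim_null_comparison[rotated]) (simp add: bound)
    moreover have "(\<lambda>k. av (\<lambda>y. g (T y)) (s (r k)) - av g (s (r k))) \<longlonglongrightarrow>
                     integral\<^sup>L N (\<lambda>y. g (T y)) - integral\<^sup>L N g"
      by (intro tendsto_diff lim' gT g(1))
    ultimately have "integral\<^sup>L N (\<lambda>y. g (T y)) = integral\<^sup>L N g"
      using LIMSEQ_unique by fastforce
    moreover have "g \<in> borel_measurable N"
      using borel_measurable_continuous_onI[OF g(1)] measurable_cong_sets[OF N(2) refl] by blast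
    ultimately show "integral\<^sup>L (distr N N T) g = integral\<^sup>L N g"
      by (simp add: integral_distr[OF TN])
  qed (use N in auto)
  hence "invariant_prob T N" unfolding invariant_prob_def using N TN by simp
  hence "N = \<mu>" using \<mu> by (simp add: uniquely_ergodic_def)
  hence "(\<lambda>k. av \<phi> (s (r k))) \<longlonglongrightarrow> integral\<^sup>L \<mu> \<phi>" using lim'[OF \<phi>] by simp
  from tendstoD[OF this e(1)] show False using s(3) by (simp add: eventually_sequentially)
qed

section \<open>The moment generating function of a biased spin\<close>

text \<open>Expectation of exp (z * sigma) for a spin with P(sigma = 1) = p. The field is left
  generic: complex arguments serve the limit, real ones the dominating bound.\<close>

definition spin_mgf :: "real \<Rightarrow> 'a \<Rightarrow> 'a::{real_normed_field,banach}" where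
  "spin_mgf p z = of_real p * exp z + of_real (1 - p) * exp (- z)"

text \<open>The spin minus its mean 2p - 1 takes the value 2(1-p) with probability p and -2p with
  probability 1-p.\<close>

definition centred_mgf :: "real \<Rightarrow> 'a \<Rightarrow> 'a::{real_normed_field,banach}" where
  "centred_mgf p z = of_real p * exp (of_real (2 * (1 - p)) * z) + of_real (1 - p) * exp (of_real (- 2 * p) * z)"

lemma spin_mgf_eq_centred: "spin_mgf p z = exp (of_real (2 * p - 1) * z) * centred_mgf p z"
proof -
  have "exp z = exp (of_real (2 * p - 1) * z) * exp (of_real (2 * (1 - p)) * z)"
    unfolding exp_add[symmetric] by (simp add: algebra_simps flip: distrib_right)
  moreover have "exp (- z) = exp (of_real (2 * p - 1) * z) * exp (of_real (- 2 * p) * z)"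
    unfolding exp_add[symmetric] by (simp add: algebra_simps)
  ultimately show ?thesis unfolding spin_mgf_def centred_mgf_def by (simp add: algebra_simps)
qed

lemma norm_spin_mgf_le:
  assumes "p \<in> {0..1}" shows "norm (spin_mgf p (z :: complex)) \<le> spin_mgf p (Re z)"
  unfolding spin_mgf_def using assms by (intro order_trans[OF norm_triangle_ineq]) (auto simp: norm_mult simp del: of_real_diff)

lemma continuous_on_spin_mgf [continuous_intros]:
  assumes "continuous_on S g" shows "continuous_on S (\<lambda>x. spin_mgf p (g x))"
  unfolding spin_mgf_def by (intro continuous_intros assms)

text \<open>The first-order term vanishes by centring and 2p(1-p) is half the variance. The constant
  comes from both values of the centred spin being at most 2 in modulus: (2 |z|)^3 * exp 2 /
  2.\<close>

lemma centred_mgf_taylor: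
  fixes z :: "'a::{real_normed_field,banach}"
  assumes p: "p \<in> {0..1}" and z: "norm z \<le> 1"
  shows "norm (centred_mgf p z - (1 + of_real (2 * p * (1 - p)) * z\<^sup>2)) \<le> 4 * exp 2 * norm z ^ 3"
proof -
  have *: "norm (exp (of_real c * z) - (1 + of_real c * z + (of_real c * z)\<^sup>2 / 2)) \<le> 4 * exp 2 * norm z ^ 3"
    if "\<bar>c\<bar> \<le> 2" for c :: real
  proof -
    have n: "norm (of_real c * z) \<le> 2 * norm z" using that by (simp add: norm_mult mult_right_mono)
    have "norm (exp (of_real c * z) - (1 + of_real c * z + (of_real c * z)\<^sup>2 / 2))
          \<le> exp (norm (of_real c * z)) * norm (of_real c * z) ^ 3 / 2"
      using Taylor_exp_field[of "of_real c * z" 2] by (simp add: numeral_eq_Suc)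
    also have "\<dots> \<le> exp 2 * (2 * norm z) ^ 3 / 2"
      using n z by (intro divide_right_mono mult_mono power_mono) auto
    finally show ?thesis by (simp add: power_mult_distrib)
  qed
  define r where "r c = exp (of_real c * z) - (1 + of_real c * z + (of_real c * z)\<^sup>2 / 2)" for c
  have "centred_mgf p z - (1 + of_real (2 * p * (1 - p)) * z\<^sup>2) =
        of_real p * r (2 * (1 - p)) + of_real (1 - p) * r (- 2 * p)"
    unfolding centred_mgf_def r_def by (simp add: field_simps power2_eq_square)
  also have "norm \<dots> \<le> p * norm (r (2 * (1 - p))) + (1 - p) * norm (r (- 2 * p))"
    using p by (intro order_trans[OF norm_triangle_ineq]) (simp add: norm_mult del: of_real_diff)
  also have "\<dots> \<le> p * (4 * exp 2 * norm z ^ 3) + (1 - p) * (4 * exp 2 * norm z ^ 3)"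
    using p unfolding r_def by (intro add_mono mult_left_mono *) auto
  finally show ?thesis by (simp add: algebra_simps)
qed

text \<open>Dividing every factor by \<open>B\<close> reduces this to the telescoping estimate for
  factors in the unit ball.\<close>

lemma norm_prod_diff_le:
  fixes v w :: "'i \<Rightarrow> 'a::{real_normed_field}"
  assumes "finite I" and "B \<ge> 1" and "\<And>i. i \<in> I \<Longrightarrow> norm (v i) \<le> B" and "\<And>i. i \<in> I \<Longrightarrow> norm (w i) \<le> B"
  shows "norm ((\<Prod>i\<in>I. v i) - (\<Prod>i\<in>I. w i)) \<le> B ^ card I * (\<Sum>i\<in>I. norm (v i - w i))"
proof -
  define b :: 'a where "b = of_real B"
  have b: "b \<noteq> 0" "norm b = B" using assms(2) by (auto simp: b_def)
  have "norm ((\<Prod>i\<in>I. v i / b) - (\<Prod>i\<in>I. w i / b)) \<le> (\<Sum>i\<in>I. norm (v i / b - w i / b))"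
    using assms b by (intro norm_prod_diff) (auto simp: norm_divide)
  also have "\<dots> \<le> (\<Sum>i\<in>I. norm (v i - w i))"
    using assms(2) b by (intro sum_mono) (simp add: norm_divide divide_le_eq mult_le_cancel_left1 flip: diff_divide_distrib)
  also have "(\<Prod>i\<in>I. v i / b) - (\<Prod>i\<in>I. w i / b) = ((\<Prod>i\<in>I. v i) - (\<Prod>i\<in>I. w i)) / b ^ card I"
    by (simp add: prod_dividef diff_divide_distrib)
  finally show ?thesis using assms(2) b by (simp add: norm_divide norm_power divide_le_eq mult.commute)
qed

text \<open>The 5 is 4 from the Taylor estimate plus 1 from replacing 1 + q by exp q. The size
  bounds have the form exp (const * |z|^2) so that a product of n factors with |z| of order 1 / sqrt
  n stays bounded.\<close>

lemma centred_mgf_exp_approx: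
  fixes z :: "'a::{real_normed_field,banach}"
  assumes p: "p \<in> {0..1}" and z: "norm z \<le> 1"
  defines "q \<equiv> of_real (2 * p * (1 - p)) * z\<^sup>2"
  shows "norm (centred_mgf p z - exp q) \<le> 5 * exp 2 * norm z ^ 3"
    and "norm (centred_mgf p z) \<le> exp (5 * exp 2 * (norm z)\<^sup>2)"
    and "norm (exp q) \<le> exp (5 * exp 2 * (norm z)\<^sup>2)"
proof -
  have e2: "exp 2 \<ge> (1::real)" by simp
  have "0 \<le> 2 * p * (1 - p)" using p by simp
  moreover have "2 * p * (1 - p) \<le> 1" using p sum_squares_bound[of p "1-p"] zero_le_power2[of "p - (1-p)"]
    by (auto simp: power2_eq_square algebra_simps)
  ultimately have c: "\<bar>2 * p * (1 - p)\<bar> \<le> 1" by simp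
  have "norm q = \<bar>2 * p * (1 - p)\<bar> * (norm z)\<^sup>2" unfolding q_def norm_mult norm_of_real norm_power ..
  also have "\<dots> \<le> 1 * (norm z)\<^sup>2" using c by (intro mult_right_mono) auto
  finally have q: "norm q \<le> (norm z)\<^sup>2" by simp
  have z2: "(norm z)\<^sup>2 \<le> 1" using z by (simp add: power_le_one)
  have z3: "norm z ^ 3 \<le> (norm z)\<^sup>2" using z by (intro power_decreasing) auto
  have z43: "(norm z) ^ 4 \<le> norm z ^ 3" using z by (intro power_decreasing) auto
  have "norm (exp q - (1 + q)) \<le> exp (norm q) * (norm q)\<^sup>2"
    using Taylor_exp_field[of q 1] by (simp add: numeral_eq_Suc)
  also have "\<dots> \<le> exp 2 * ((norm z)\<^sup>2)\<^sup>2"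
    using q z2 by (intro mult_mono power_mono) auto
  also have "((norm z)\<^sup>2)\<^sup>2 = norm z ^ 4" by (simp flip: power_mult)
  also have "exp 2 * \<dots> \<le> exp 2 * norm z ^ 3" using z43 by simp
  finally have "norm (exp q - (1 + q)) \<le> exp 2 * norm z ^ 3" .
  moreover have t: "norm (centred_mgf p z - (1 + q)) \<le> 4 * exp 2 * norm z ^ 3"
    unfolding q_def by (rule centred_mgf_taylor[OF p z])
  ultimately show "norm (centred_mgf p z - exp q) \<le> 5 * exp 2 * norm z ^ 3"
    using norm_triangle_ineq4[of "centred_mgf p z - (1 + q)" "exp q - (1 + q)"] by (simp add: algebra_simps)
  have "norm (centred_mgf p z) \<le> norm (centred_mgf p z - (1 + q)) + norm (1 + q)"
    using norm_triangle_ineq[of "centred_mgf p z - (1 + q)" "1 + q"] by simp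
  also have "\<dots> \<le> 4 * exp 2 * norm z ^ 3 + (1 + norm q)"
    using t norm_triangle_ineq[of 1 q] by simp
  also have "\<dots> \<le> 1 + 5 * exp 2 * (norm z)\<^sup>2"
  proof -
    have "4 * exp 2 * norm z ^ 3 \<le> 4 * exp 2 * (norm z)\<^sup>2" using z3 by simp
    moreover have "(norm z)\<^sup>2 \<le> exp 2 * (norm z)\<^sup>2" using e2 by (simp add: mult_le_cancel_right1)
    ultimately show ?thesis using q by linarith
  qed
  also have "\<dots> \<le> exp (5 * exp 2 * (norm z)\<^sup>2)" by (rule exp_ge_add_one_self)
  finally show "norm (centred_mgf p z) \<le> exp (5 * exp 2 * (norm z)\<^sup>2)" .
  have "norm q \<le> 5 * exp 2 * (norm z)\<^sup>2"
    using q mult_right_mono[of 1 "5 * exp 2" "(norm z)\<^sup>2"] e2 by simp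
  thus "norm (exp q) \<le> exp (5 * exp 2 * (norm z)\<^sup>2)" using norm_exp[of q] by (meson exp_le_cancel_iff order_trans)
qed

text \<open>Each factor is exchanged for a Gaussian one with the same variance. The n errors of
  order n^(-3/2) add up to order n^(-1/2), and the product of the Gaussian factors depends on the
  average variance alone. The argument \<open>z\<close> varies with n because later the frequency
  does.\<close>

lemma prod_centred_mgf_tendsto:
  fixes z :: "nat \<Rightarrow> 'a::{real_normed_field,banach}"
  assumes p: "\<And>i. p i \<in> {0..1::real}" and lim: "(\<lambda>n. (\<Sum>i=1..n. 4 * p i * (1 - p i)) / real n) \<longlonglongrightarrow> a"
    and z: "z \<longlonglongrightarrow> \<zeta>"
  shows "(\<lambda>n. \<Prod>i=1..n. centred_mgf (p i) (z n / of_real (sqrt (real n)))) \<longlonglongrightarrow> exp (of_real (a / 2) * \<zeta>\<^sup>2)"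
proof -
  define D :: real where "D = 5 * exp 2"
  define y where "y n = z n / of_real (sqrt (real n))" for n
  define e where "e n = (\<Prod>i=1..n. exp (of_real (2 * p i * (1 - p i)) * (y n)\<^sup>2))" for n
  have sq: "(\<lambda>n. 1 / sqrt (real n)) \<longlonglongrightarrow> 0"
    using tendsto_divide_0[OF tendsto_const filterlim_at_top_imp_at_infinity[OF filterlim_compose[OF sqrt_at_top filterlim_real_sequentially]]] .
  have ny: "norm (y n) = norm (z n) * (1 / sqrt (real n))" for n
    by (simp add: y_def norm_divide)
  have "(\<lambda>n. norm (y n)) \<longlonglongrightarrow> norm \<zeta> * 0"
    unfolding ny by (intro tendsto_mult tendsto_norm z sq)
  hence "(\<lambda>n. norm (y n)) \<longlonglongrightarrow> 0" by simp
  hence small: "\<forall>\<^sub>F n in sequentially. norm (y n) < 1" by (rule order_tendstoD) simp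
  have bound: "\<forall>\<^sub>F n in sequentially. norm ((\<Prod>i=1..n. centred_mgf (p i) (y n)) - e n)
                 \<le> exp (D * norm (z n) ^ 2) * (D * norm (z n) ^ 3 * (1 / sqrt (real n)))"
    using small eventually_gt_at_top[of 0]
  proof eventually_elim
    case (elim n)
    have y1: "norm (y n) \<le> 1" using elim by simp
    have "norm ((\<Prod>i=1..n. centred_mgf (p i) (y n)) - e n) \<le> exp (D * (norm (y n))\<^sup>2) ^ card {1..n} *
             (\<Sum>i=1..n. norm (centred_mgf (p i) (y n) - exp (of_real (2 * p i * (1 - p i)) * (y n)\<^sup>2)))"
      unfolding e_def D_def
      by (intro norm_prod_diff_le centred_mgf_exp_approx(2,3)[OF p y1]) auto
    also have "\<dots> \<le> exp (D * (norm (y n))\<^sup>2) ^ card {1..n} * (\<Sum>i=1..n. D * norm (y n) ^ 3)"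
      unfolding D_def by (intro mult_left_mono sum_mono centred_mgf_exp_approx(1)[OF p y1]) auto
    also have "exp (D * (norm (y n))\<^sup>2) ^ card {1..n} = exp (D * norm (z n) ^ 2)"
      using elim unfolding ny by (simp add: power_mult_distrib power_divide flip: exp_of_nat_mult)
    also have "(\<Sum>i=1..n. D * norm (y n) ^ 3) = D * norm (z n) ^ 3 * (1 / sqrt (real n))"
    proof -
      have "(\<Sum>i=1..n. D * norm (y n) ^ 3) = D * (real n * (norm (z n) / sqrt (real n)) ^ 3)"
        unfolding ny by simp
      also have "real n * (norm (z n) / sqrt (real n)) ^ 3 = norm (z n) ^ 3 / sqrt (real n)"
        using elim by (simp add: power3_eq_cube divide_simps)
      finally show ?thesis by simp
    qed
    finally show ?case .
  qed
  have "(\<lambda>n. exp (D * norm (z n) ^ 2) * (D * norm (z n) ^ 3 * (1 / sqrt (real n))))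
          \<longlonglongrightarrow> exp (D * norm \<zeta> ^ 2) * (D * norm \<zeta> ^ 3 * 0)"
    by (intro tendsto_intros z sq)
  hence "(\<lambda>n. exp (D * norm (z n) ^ 2) * (D * norm (z n) ^ 3 * (1 / sqrt (real n)))) \<longlonglongrightarrow> 0" by simp
  hence diff: "(\<lambda>n. (\<Prod>i=1..n. centred_mgf (p i) (y n)) - e n) \<longlonglongrightarrow> 0"
    by (rule Lim_null_comparison[OF bound])
  have "\<forall>\<^sub>F n in sequentially. exp (of_real ((\<Sum>i=1..n. 4 * p i * (1 - p i)) / real n / 2) * (z n)\<^sup>2) = e n"
    using eventually_gt_at_top[of 0]
  proof eventually_elim
    case (elim n)
    have "e n = exp (\<Sum>i=1..n. of_real (2 * p i * (1 - p i)) * (y n)\<^sup>2)"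
      unfolding e_def by (simp add: exp_sum)
    also have "(\<Sum>i=1..n. of_real (2 * p i * (1 - p i)) * (y n)\<^sup>2) = of_real (\<Sum>i=1..n. 2 * p i * (1 - p i)) * (y n)\<^sup>2"
      unfolding of_real_sum sum_distrib_right ..
    also have "(y n)\<^sup>2 = (z n)\<^sup>2 / of_real (real n)"
      unfolding y_def power_divide of_real_power[symmetric] by simp
    also have "(\<Sum>i=1..n. 2 * p i * (1 - p i)) = (\<Sum>i=1..n. 4 * p i * (1 - p i)) / 2"
      unfolding sum_divide_distrib by (intro sum.cong) auto
    finally show ?case by (simp add: mult.commute)
  qed
  moreover have "(\<lambda>n. exp (of_real ((\<Sum>i=1..n. 4 * p i * (1 - p i)) / real n / 2) * (z n)\<^sup>2))
                   \<longlonglongrightarrow> exp (of_real (a / 2) * \<zeta>\<^sup>2)"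
    by (intro tendsto_intros z lim) auto
  ultimately have "e \<longlonglongrightarrow> exp (of_real (a / 2) * \<zeta>\<^sup>2)" by (rule Lim_transform_eventually[rotated])
  from tendsto_add[OF diff this] show ?thesis by (simp add: y_def)
qed

section \<open>Cumulant functions of centred spins and their quadratic bounds\<close>

definition ln_centred_mgf :: "real \<Rightarrow> real \<Rightarrow> real" where
  "ln_centred_mgf p u = ln (centred_mgf p u)"

text \<open>Jensen's inequality for a variable of mean zero, in the form 1 + x <= exp x.\<close>

lemma centred_mgf_ge_1:
  assumes "p \<in> {0..1}" shows "centred_mgf p (u :: real) \<ge> 1"
proof -
  have "1 = p * (1 + 2 * (1 - p) * u) + (1 - p) * (1 + (- 2 * p) * u)" by (simp add: algebra_simps)
  also have "\<dots> \<le> p * exp (2 * (1 - p) * u) + (1 - p) * exp (- 2 * p * u)"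
    using assms by (intro add_mono mult_left_mono exp_ge_add_one_self) auto
  finally show ?thesis by (simp add: centred_mgf_def)
qed

lemma centred_mgf_pos: "p \<in> {0..1} \<Longrightarrow> centred_mgf p (u :: real) > 0"
  using centred_mgf_ge_1[of p u] by linarith

lemma ln_centred_mgf_0 [simp]: "ln_centred_mgf p 0 = 0"
  by (simp add: ln_centred_mgf_def centred_mgf_def)

lemma exp_ln_centred_mgf: "p \<in> {0..1} \<Longrightarrow> exp (ln_centred_mgf p u) = centred_mgf p u"
  by (simp add: ln_centred_mgf_def centred_mgf_pos)

lemma ln_spin_mgf:
  assumes "p \<in> {0..1}" shows "ln (spin_mgf p u) = (2 * p - 1) * u + ln_centred_mgf p u"
  using centred_mgf_pos[OF assms, of u]
  by (simp add: spin_mgf_eq_centred ln_centred_mgf_def ln_mult)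

text \<open>A centred spin is bounded by 2, so moving from \<open>v\<close> to \<open>u\<close>
  multiplies each exponential by at most exp (2 |u - v|). As \<open>u\<close> and \<open>v\<close>
  may be exchanged, this is a Lipschitz bound independent of \<open>p\<close>.\<close>

lemma ln_centred_mgf_le_add:
  assumes "p \<in> {0..1}" shows "ln_centred_mgf p u \<le> ln_centred_mgf p v + 2 * \<bar>u - v\<bar>"
proof -
  have *: "exp (c * u) \<le> exp (c * v) * exp (2 * \<bar>u - v\<bar>)" if "\<bar>c\<bar> \<le> 2" for c :: real
  proof -
    have "c * (u - v) \<le> \<bar>c\<bar> * \<bar>u - v\<bar>" by (metis abs_ge_self abs_mult)
    also have "\<dots> \<le> 2 * \<bar>u - v\<bar>" using that by (intro mult_right_mono) auto
    finally show ?thesis unfolding exp_add[symmetric] by (simp add: algebra_simps)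
  qed
  have "centred_mgf p u \<le> p * (exp (2 * (1 - p) * v) * exp (2 * \<bar>u - v\<bar>)) +
          (1 - p) * (exp (- 2 * p * v) * exp (2 * \<bar>u - v\<bar>))"
    unfolding centred_mgf_def of_real_eq_id id_apply using assms by (intro add_mono mult_left_mono *) auto
  also have "\<dots> = centred_mgf p v * exp (2 * \<bar>u - v\<bar>)" by (simp add: centred_mgf_def algebra_simps)
  finally have "ln (centred_mgf p u) \<le> ln (centred_mgf p v * exp (2 * \<bar>u - v\<bar>))"
    using centred_mgf_pos[OF assms] by (subst ln_le_cancel_iff) auto
  thus ?thesis using centred_mgf_pos[OF assms, of v] by (simp add: ln_centred_mgf_def ln_mult)
qed

lemma ln_centred_mgf_le: "p \<in> {0..1} \<Longrightarrow> ln_centred_mgf p u \<le> 2 * \<bar>u\<bar>"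
  using ln_centred_mgf_le_add[of p u 0] by simp

text \<open>With \<open>d\<close> the excess of the generating function over 1, ln (1 + d) lies
  between d - d^2 and d. Here d is at most (1 + E) u^2, so d^2 is of order u^4 and is absorbed in
  the cubic error. The constant is uniform in \<open>p\<close>, which permits averaging over
  sites.\<close>

lemma ln_centred_mgf_taylor:
  obtains C where "C \<ge> 0"
    "\<And>p u. p \<in> {0..1} \<Longrightarrow> \<bar>u\<bar> \<le> 1 \<Longrightarrow> \<bar>ln_centred_mgf p u - 2 * p * (1 - p) * u\<^sup>2\<bar> \<le> C * \<bar>u\<bar> ^ 3"
proof
  define E :: real where "E = 4 * exp 2"
  have E: "E \<ge> 0" by (simp add: E_def)
  show "E + (1 + E)\<^sup>2 \<ge> 0" using E by simp
  fix p u :: real assume p: "p \<in> {0..1}" and u: "\<bar>u\<bar> \<le> 1"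
  define d where "d = centred_mgf p u - 1"
  define c where "c = 2 * p * (1 - p)"
  have d0: "d \<ge> 0" using centred_mgf_ge_1[OF p] by (simp add: d_def)
  have t: "\<bar>d - c * u\<^sup>2\<bar> \<le> E * \<bar>u\<bar> ^ 3"
    using centred_mgf_taylor[OF p, of u] u by (simp add: d_def c_def E_def)
  have c1: "c \<le> 1" unfolding c_def using p sum_squares_bound[of p "1-p"] zero_le_power2[of "p - (1-p)"]
    by (auto simp: power2_eq_square algebra_simps)
  have u3: "\<bar>u\<bar> ^ 3 \<le> u\<^sup>2" using power_decreasing[of 2 3 "\<bar>u\<bar>"] u by simp
  have u43: "u ^ 4 \<le> \<bar>u\<bar> ^ 3" using power_decreasing[of 3 4 "\<bar>u\<bar>"] u by simp
  have "d \<le> c * u\<^sup>2 + E * \<bar>u\<bar> ^ 3" using t by linarith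
  also have "\<dots> \<le> 1 * u\<^sup>2 + E * u\<^sup>2" using c1 E u3 by (intro add_mono mult_mono) auto
  finally have "d\<^sup>2 \<le> ((1 + E) * u\<^sup>2)\<^sup>2" using d0 by (intro power_mono) (simp_all add: algebra_simps)
  also have "\<dots> = (1 + E)\<^sup>2 * u ^ 4" by (simp add: power_mult_distrib flip: power_mult)
  also have "\<dots> \<le> (1 + E)\<^sup>2 * \<bar>u\<bar> ^ 3" using u43 by (intro mult_left_mono) auto
  finally have d2: "d\<^sup>2 \<le> (1 + E)\<^sup>2 * \<bar>u\<bar> ^ 3" .
  \<comment> \<open>The library bound covers d <= 1; beyond that the left side is not
    positive.\<close>
  have "d - d\<^sup>2 \<le> ln (1 + d)"
  proof (cases "d \<le> 1")
    case False
    hence "d - d\<^sup>2 \<le> 0" by (simp add: power2_eq_square)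
    also have "0 \<le> ln (1 + d)" using d0 by simp
    finally show ?thesis .
  qed (use d0 ln_one_plus_pos_lower_bound in blast)
  moreover have "ln (1 + d) \<le> d" using d0 by (rule ln_add_one_self_le_self)
  moreover have "ln_centred_mgf p u = ln (1 + d)" by (simp add: ln_centred_mgf_def d_def)
  moreover have "0 \<le> (1 + E)\<^sup>2 * \<bar>u\<bar> ^ 3" by simp
  ultimately have "\<bar>ln_centred_mgf p u - c * u\<^sup>2\<bar> \<le> E * \<bar>u\<bar> ^ 3 + (1 + E)\<^sup>2 * \<bar>u\<bar> ^ 3"
    using t d2 by linarith
  thus "\<bar>ln_centred_mgf p u - 2 * p * (1 - p) * u\<^sup>2\<bar> \<le> (E + (1 + E)\<^sup>2) * \<bar>u\<bar> ^ 3"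
    by (simp add: c_def distrib_right)
qed

text \<open>Near \<open>0\<close> the Taylor expansion is used, for large \<open>u\<close> the linear bound, and in between
  the equi-Lipschitz property together with compactness.\<close>

lemma eventually_average_ln_centred_mgf_le:
  assumes p: "\<And>i. p i \<in> {0..1}"
    and H: "\<And>u. (\<lambda>n. (\<Sum>i=1..n. ln_centred_mgf (p i) u) / real n) \<longlonglongrightarrow> H u"
    and var: "(\<lambda>n. (\<Sum>i=1..n. 4 * p i * (1 - p i)) / real n) \<longlonglongrightarrow> a"
    and Hle: "\<And>u. H u \<le> \<rho>1 * u\<^sup>2" and a: "a / 2 \<le> \<rho>1" and \<rho>: "0 < \<rho>1" "\<rho>1 < \<rho>"
  shows "\<forall>\<^sub>F n in sequentially. \<forall>u. (\<Sum>i=1..n. ln_centred_mgf (p i) u) / real n \<le> \<rho> * u\<^sup>2"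
proof -
  define A where "A n u = (\<Sum>i=1..n. ln_centred_mgf (p i) u) / real n" for n u
  have A_add: "A n u \<le> A n v + 2 * \<bar>u - v\<bar>" for n u v
  proof (cases "n = 0")
    case False
    have "(\<Sum>i=1..n. ln_centred_mgf (p i) u) \<le> (\<Sum>i=1..n. ln_centred_mgf (p i) v + 2 * \<bar>u - v\<bar>)"
      by (intro sum_mono ln_centred_mgf_le_add p)
    thus ?thesis using False unfolding A_def by (simp add: sum.distrib field_simps)
  qed (simp add: A_def)
  have A0: "A n 0 = 0" for n by (simp add: A_def)
  obtain C where C: "C \<ge> 0"
    "\<And>p u. p \<in> {0..1} \<Longrightarrow> \<bar>u\<bar> \<le> 1 \<Longrightarrow> \<bar>ln_centred_mgf p u - 2 * p * (1 - p) * u\<^sup>2\<bar> \<le> C * \<bar>u\<bar> ^ 3"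
    by (rule ln_centred_mgf_taylor) (rule that)
  \<comment> \<open>The gap is halved because two errors must fit into it near 0: the fluctuation of
    the average variance and the cubic Taylor remainder.\<close>
  define \<eta> where "\<eta> = (\<rho> - \<rho>1) / 2"
  have \<eta>: "\<eta> > 0" using \<rho> by (simp add: \<eta>_def)
  \<comment> \<open>Chosen so that C |u|^3 <= \<eta> u^2 for |u| <= \<delta>; the denominator C + 1
    avoids dividing by 0.\<close>
  define \<delta> where "\<delta> = min 1 (\<eta> / (C + 1))"
  have \<delta>: "\<delta> > 0" "\<delta> \<le> 1" using \<eta> C(1) by (auto simp: \<delta>_def)
  have "C * \<delta> \<le> (C + 1) * (\<eta> / (C + 1))" using C(1) \<eta> \<delta> unfolding \<delta>_def by (intro mult_mono) auto
  hence C\<delta>: "C * \<delta> \<le> \<eta>" using C(1) by simp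
  have "(\<lambda>n. (\<Sum>i=1..n. 4 * p i * (1 - p i)) / real n / 2) \<longlonglongrightarrow> a / 2"
    by (intro tendsto_intros var) auto
  hence "\<forall>\<^sub>F n in sequentially. (\<Sum>i=1..n. 4 * p i * (1 - p i)) / real n / 2 < \<rho>1 + \<eta>"
    by (rule order_tendstoD) (use a \<eta> in linarith)
  hence near: "\<forall>\<^sub>F n in sequentially. \<forall>u. \<bar>u\<bar> \<le> \<delta> \<longrightarrow> A n u \<le> \<rho> * u\<^sup>2"
    using eventually_gt_at_top[of 0]
  proof eventually_elim
    case (elim n)
    show ?case
    proof (intro allI impI)
      fix u :: real assume u: "\<bar>u\<bar> \<le> \<delta>"
      have "(\<Sum>i=1..n. ln_centred_mgf (p i) u) \<le> (\<Sum>i=1..n. 4 * p i * (1 - p i) * (u\<^sup>2 / 2) + C * \<bar>u\<bar> ^ 3)"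
      proof (rule sum_mono)
        fix i
        have "4 * p i * (1 - p i) * (u\<^sup>2 / 2) = 2 * p i * (1 - p i) * u\<^sup>2" by simp
        moreover have "\<bar>ln_centred_mgf (p i) u - 2 * p i * (1 - p i) * u\<^sup>2\<bar> \<le> C * \<bar>u\<bar> ^ 3"
          using C(2)[OF p, of u i] u \<delta> by linarith
        ultimately show "ln_centred_mgf (p i) u \<le> 4 * p i * (1 - p i) * (u\<^sup>2 / 2) + C * \<bar>u\<bar> ^ 3"
          by linarith
      qed
      also have "\<dots> = (\<Sum>i=1..n. 4 * p i * (1 - p i)) * (u\<^sup>2 / 2) + real n * (C * \<bar>u\<bar> ^ 3)"
        unfolding sum.distrib sum_distrib_right[symmetric] by simp
      finally have "A n u \<le> (\<Sum>i=1..n. 4 * p i * (1 - p i)) / real n / 2 * u\<^sup>2 + C * \<bar>u\<bar> ^ 3"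
        using elim unfolding A_def by (simp add: field_simps)
      also have "C * \<bar>u\<bar> ^ 3 = C * \<bar>u\<bar> * u\<^sup>2" by (simp add: power3_eq_cube power2_eq_square)
      also have "\<dots> \<le> \<eta> * u\<^sup>2"
        using C\<delta> C(1) u mult_left_mono[of "\<bar>u\<bar>" \<delta> C] by (intro mult_right_mono) auto
      also have "(\<Sum>i=1..n. 4 * p i * (1 - p i)) / real n / 2 * u\<^sup>2 \<le> (\<rho>1 + \<eta>) * u\<^sup>2"
        using elim by (intro mult_right_mono) auto
      also have "(\<rho>1 + \<eta>) * u\<^sup>2 + \<eta> * u\<^sup>2 = \<rho> * u\<^sup>2" by (simp add: \<eta>_def field_simps)
      finally show "A n u \<le> \<rho> * u\<^sup>2" by simp
    qed
  qed
  \<comment> \<open>From here on the linear bound 2 |u| lies below \<rho> u^2, for every n.\<close>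
  define R where "R = 2 / \<rho>"
  have far: "A n u \<le> \<rho> * u\<^sup>2" if "\<bar>u\<bar> \<ge> R" for n u
  proof -
    have "2 \<le> \<rho> * \<bar>u\<bar>" using that \<rho> by (simp add: R_def field_simps)
    hence "2 * \<bar>u\<bar> \<le> \<rho> * \<bar>u\<bar> * \<bar>u\<bar>" by (intro mult_right_mono) auto
    thus ?thesis using A_add[of n u 0] A0[of n] by (simp add: power2_eq_square)
  qed
  define K where "K = {u. \<delta> \<le> \<bar>u\<bar>} \<inter> {-R..R}"
  have "compact K" unfolding K_def
    by (intro closed_Int_compact closed_Collect_le continuous_intros) auto
  have "\<exists>U. open U \<and> v \<in> U \<and> (\<forall>\<^sub>F n in sequentially. \<forall>u\<in>U. A n u \<le> \<rho> * u\<^sup>2)" if "v \<in> K" for v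
  proof -
    \<comment> \<open>The midpoint leaves room on both sides: eventually \<open>A n v\<close> <
      \<open>s\<close>, and \<rho> u^2 still exceeds \<open>s\<close> by more than the Lipschitz
      error 2 |u - v| for \<open>u\<close> near \<open>v\<close>.\<close>
    define s where "s = (\<rho>1 * v\<^sup>2 + \<rho> * v\<^sup>2) / 2"
    have "v \<noteq> 0" using that \<delta> by (auto simp: K_def)
    hence "\<rho>1 * v\<^sup>2 < \<rho> * v\<^sup>2" using \<rho> by (intro mult_strict_right_mono) auto
    hence s: "\<rho>1 * v\<^sup>2 < s" "s < \<rho> * v\<^sup>2" by (auto simp: s_def)
    let ?U = "{u. s < \<rho> * u\<^sup>2 - 2 * \<bar>u - v\<bar>}"
    have "open ?U" by (intro open_Collect_less continuous_intros)
    moreover have "v \<in> ?U" using s by simp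
    moreover have "\<forall>\<^sub>F n in sequentially. A n v < s"
      using H[of v, folded A_def] by (rule order_tendstoD) (use Hle[of v] s in linarith)
    hence "\<forall>\<^sub>F n in sequentially. \<forall>u\<in>?U. A n u \<le> \<rho> * u\<^sup>2"
    proof eventually_elim
      case (elim n)
      show ?case
      proof
        fix u assume "u \<in> ?U"
        thus "A n u \<le> \<rho> * u\<^sup>2" using A_add[of n u v] elim by simp
      qed
    qed
    ultimately show ?thesis by blast
  qed
  hence "\<forall>v\<in>K. \<exists>U. open U \<and> v \<in> U \<and> (\<forall>\<^sub>F n in sequentially. \<forall>u\<in>U. A n u \<le> \<rho> * u\<^sup>2)"
    by (rule ballI)
  from bchoice[OF this] obtain U where
    "\<forall>v\<in>K. open (U v) \<and> v \<in> U v \<and> (\<forall>\<^sub>F n in sequentially. \<forall>u\<in>U v. A n u \<le> \<rho> * u\<^sup>2)" ..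
  note U = this[THEN bspec, THEN conjunct1] this[THEN bspec, THEN conjunct2, THEN conjunct1]
    this[THEN bspec, THEN conjunct2, THEN conjunct2]
  obtain F where F: "F \<subseteq> K" "finite F" "K \<subseteq> (\<Union>v\<in>F. U v)"
  proof (rule compactE_image[OF \<open>compact K\<close>, of K U])
    show "open (U v)" if "v \<in> K" for v using that by (rule U(1))
    show "K \<subseteq> (\<Union>v\<in>K. U v)"
    proof
      fix v assume "v \<in> K"
      show "v \<in> (\<Union>v\<in>K. U v)" by (rule UN_I[where B = U, OF \<open>v \<in> K\<close> U(2)[OF \<open>v \<in> K\<close>]])
    qed
  qed (rule that)
  have "\<forall>\<^sub>F n in sequentially. \<forall>v\<in>F. \<forall>u\<in>U v. A n u \<le> \<rho> * u\<^sup>2"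
  proof (rule eventually_ball_finite[OF F(2)], rule ballI)
    fix v assume "v \<in> F"
    hence "v \<in> K" using F(1) by blast
    thus "\<forall>\<^sub>F n in sequentially. \<forall>u\<in>U v. A n u \<le> \<rho> * u\<^sup>2" by (rule U(3))
  qed
  with near have "\<forall>\<^sub>F n in sequentially. \<forall>u. A n u \<le> \<rho> * u\<^sup>2"
  proof eventually_elim
    case (elim n)
    show ?case
    proof
      fix u
      consider "\<bar>u\<bar> \<le> \<delta>" | "\<bar>u\<bar> \<ge> R" | "u \<in> K"
        unfolding K_def Int_iff mem_Collect_eq atLeastAtMost_iff by linarith
      thus "A n u \<le> \<rho> * u\<^sup>2"
      proof cases
        case 1
        thus ?thesis using elim(1) by blast
      next
        case 2
        thus ?thesis by (rule far)
      next
        case 3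
        then obtain v where "v \<in> F" "u \<in> U v" using F(3) by blast
        thus ?thesis using elim(2) by blast
      qed
    qed
  qed
  thus ?thesis by (simp add: A_def)
qed

section \<open>Cumulant functions integrated over the phase space\<close>

lemma integrable_ln_centred_mgf:
  assumes M: "prob_space M" and f: "f \<in> borel_measurable M" "\<And>y. f y \<in> {0..1}"
  shows "integrable M (\<lambda>y. ln_centred_mgf (f y) u)"
proof -
  interpret prob_space M by fact
  note [measurable] = f(1)
  show ?thesis
  proof (rule integrable_const_bound[of _ "2 * \<bar>u\<bar>"])
    show "AE y in M. norm (ln_centred_mgf (f y) u) \<le> 2 * \<bar>u\<bar>"
    proof (rule AE_I2)
      fix y
      have "ln_centred_mgf (f y) u \<ge> 0" using centred_mgf_ge_1[OF f(2)] by (simp add: ln_centred_mgf_def)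
      thus "norm (ln_centred_mgf (f y) u) \<le> 2 * \<bar>u\<bar>" using ln_centred_mgf_le[OF f(2), of y u] by simp
    qed
    show "(\<lambda>y. ln_centred_mgf (f y) u) \<in> borel_measurable M"
      unfolding ln_centred_mgf_def centred_mgf_def of_real_eq_id id_apply by measurable
  qed
qed

text \<open>Dividing by u^2 and letting u decrease to 0 compares second-order coefficients. This
  turns the condition on the free energy into a bound on the variance and thereby makes the
  denominator 1 - \<beta> J a positive.\<close>

lemma integral_variance_le:
  assumes M: "prob_space M" and f: "f \<in> borel_measurable M" "\<And>y. f y \<in> {0..1}"
    and le: "\<And>u. (\<integral>y. ln_centred_mgf (f y) u \<partial>M) \<le> \<rho> * u\<^sup>2"
  shows "(\<integral>y. 4 * f y * (1 - f y) \<partial>M) / 2 \<le> \<rho>"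
proof -
  interpret prob_space M by fact
  note [measurable] = f(1)
  obtain C where C: "C \<ge> 0"
    "\<And>p u. p \<in> {0..1} \<Longrightarrow> \<bar>u\<bar> \<le> 1 \<Longrightarrow> \<bar>ln_centred_mgf p u - 2 * p * (1 - p) * u\<^sup>2\<bar> \<le> C * \<bar>u\<bar> ^ 3"
    by (rule ln_centred_mgf_taylor) (rule that)
  have f01: "0 \<le> f y" "f y \<le> 1" for y using f(2)[of y] by auto
  have int: "integrable M (\<lambda>y. 4 * f y * (1 - f y))"
    by (rule integrable_const_bound[of _ 4]) (auto simp: abs_mult f01 intro!: mult_le_one)
  note intl = integrable_ln_centred_mgf[OF M f]
  let ?a = "\<integral>y. 4 * f y * (1 - f y) \<partial>M"
  have "?a / 2 - C * u \<le> \<rho>" if u: "0 < u" "u \<le> 1" for u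
  proof -
    have "4 * f y * (1 - f y) * (u\<^sup>2 / 2) - C * u ^ 3 \<le> ln_centred_mgf (f y) u" for y
      using C(2)[OF f(2), of u y] u by (simp add: abs_le_iff)
    hence "(\<integral>y. 4 * f y * (1 - f y) * (u\<^sup>2 / 2) - C * u ^ 3 \<partial>M) \<le> (\<integral>y. ln_centred_mgf (f y) u \<partial>M)"
      by (intro integral_mono intl Bochner_Integration.integrable_diff integrable_mult_left int) auto
    also have "(\<integral>y. 4 * f y * (1 - f y) * (u\<^sup>2 / 2) - C * u ^ 3 \<partial>M) = ?a * (u\<^sup>2 / 2) - C * u ^ 3"
      by (subst Bochner_Integration.integral_diff[OF integrable_mult_left[OF int] integrable_const])
         (simp only: integral_mult_left_zero lebesgue_integral_const prob_space, simp)
    also have "\<dots> = (?a / 2 - C * u) * u\<^sup>2" by (simp add: algebra_simps power2_eq_square power3_eq_cube)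
    finally have "(?a / 2 - C * u) * u\<^sup>2 \<le> \<rho> * u\<^sup>2" using le[of u] by linarith
    thus ?thesis using u by simp
  qed
  hence "\<forall>\<^sub>F u in at_right 0. ?a / 2 - C * u \<le> \<rho>"
    using eventually_at_right_less[of 0] eventually_at_right_real[of 0 1] by (auto elim!: eventually_elim2)
  moreover have "((\<lambda>u. ?a / 2 - C * u) \<longlongrightarrow> ?a / 2 - C * 0) (at_right 0)"
    by (intro tendsto_intros)
  ultimately show ?thesis using tendsto_upperbound[of "\<lambda>u. ?a / 2 - C * u" "?a / 2" "at_right 0" \<rho>] by simp
qed

section \<open>Gaussian integrals\<close>

text \<open>Completing the square: an exponential tilt shifts the mean of a Gaussian.\<close>

lemma normal_density_mult_exp:
  assumes "s > 0"
  shows "normal_density 0 s g * exp (c * g) = exp (c\<^sup>2 * s\<^sup>2 / 2) * normal_density (c * s\<^sup>2) s g"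
proof -
  have "- (g\<^sup>2 / (2 * s\<^sup>2)) + c * g = c\<^sup>2 * s\<^sup>2 / 2 + - ((g - c * s\<^sup>2)\<^sup>2 / (2 * s\<^sup>2))"
    using assms by (simp add: field_simps power2_eq_square)
  thus ?thesis unfolding normal_density_def by (simp add: mult_ac flip: exp_add)
qed

lemma has_bochner_integral_normal_density_mult_exp:
  assumes "s > 0"
  shows "has_bochner_integral lborel (\<lambda>g. normal_density 0 s g * exp (c * g)) (exp (c\<^sup>2 * s\<^sup>2 / 2))"
  unfolding normal_density_mult_exp[OF assms] has_bochner_integral_iff
  using assms by simp

lemma std_normal_density_mult_exp_square:
  assumes "\<rho> < 1"
  shows "std_normal_density g * exp (\<rho> * g\<^sup>2 / 2) = normal_density 0 (1 / sqrt (1 - \<rho>)) g / sqrt (1 - \<rho>)"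
proof -
  have "- g\<^sup>2 / 2 + \<rho> * g\<^sup>2 / 2 = - ((1 - \<rho>) * g\<^sup>2 / 2)" by (simp add: field_simps)
  hence "exp (- g\<^sup>2 / 2) * exp (\<rho> * g\<^sup>2 / 2) = exp (- ((1 - \<rho>) * g\<^sup>2 / 2))"
    by (simp flip: exp_add)
  thus ?thesis using assms
    unfolding normal_density_def by (simp add: power_divide real_sqrt_divide real_sqrt_mult field_simps)
qed

lemma integral_normal_density_iexp:
  assumes "s > 0"
  shows "(\<integral>g. complex_of_real (normal_density 0 s g) * iexp (t * g) \<partial>lborel) = of_real (exp (- (s\<^sup>2 * t\<^sup>2) / 2))"
proof -
  have "(\<integral>g. complex_of_real (normal_density 0 s g) * iexp (t * g) \<partial>lborel) =
        s *\<^sub>R (\<integral>r. complex_of_real (normal_density 0 s (0 + s * r)) * iexp (t * (0 + s * r)) \<partial>lborel)"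
    using assms by (subst lborel_integral_real_affine[where c = s and t = 0]) auto
  also have "\<dots> = (\<integral>r. s *\<^sub>R (complex_of_real (normal_density 0 s (0 + s * r)) * iexp (t * (0 + s * r))) \<partial>lborel)"
    by simp
  also have "\<dots> = (\<integral>r. std_normal_density r *\<^sub>R iexp ((s * t) * r) \<partial>lborel)"
  proof (rule Bochner_Integration.integral_cong[OF refl])
    fix r
    have "s * normal_density 0 s (s * r) = std_normal_density r"
      using assms unfolding normal_density_def by (simp add: power_mult_distrib real_sqrt_mult field_simps)
    moreover have "t * (0 + s * r) = (s * t) * r" by simp
    ultimately show "s *\<^sub>R (complex_of_real (normal_density 0 s (0 + s * r)) * iexp (t * (0 + s * r))) =
          std_normal_density r *\<^sub>R iexp ((s * t) * r)"
      by (simp only: scaleR_conv_of_real mult.assoc[symmetric] of_real_mult[symmetric] add_0)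
  qed
  also have "\<dots> = char std_normal_distribution (s * t)"
    unfolding char_def by (subst integral_density) auto
  also have "\<dots> = of_real (exp (- (s\<^sup>2 * t\<^sup>2) / 2))"
    by (simp add: char_std_normal_distribution power_mult_distrib)
  finally show ?thesis .
qed

lemma real_distribution_normal_law: "v > 0 \<Longrightarrow> real_distribution (normal_law 0 v)"
  unfolding normal_law_def real_distribution_def real_distribution_axioms_def
  by (auto intro: prob_space_normal_density)

lemma char_normal_law:
  assumes "v > 0" shows "char (normal_law 0 v) t = of_real (exp (- (v * t\<^sup>2) / 2))"
proof -
  have "char (normal_law 0 v) t = (\<integral>g. normal_density 0 (sqrt v) g *\<^sub>R iexp (t * g) \<partial>lborel)"
    unfolding char_def normal_law_def by (subst integral_density) auto
  also have "\<dots> = of_real (exp (- (v * t\<^sup>2) / 2))"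
    using integral_normal_density_iexp[of "sqrt v" t] assms by (simp add: scaleR_conv_of_real)
  finally show ?thesis .
qed

text \<open>Expanding the square, the term in g^2 changes the variance of the Gaussian to 1 / (1 - a
  \<kappa>), and the mixed term evaluates its characteristic function at a * sqrt \<kappa> *
  t.\<close>

lemma integral_gaussian_exp_square:
  assumes "\<kappa> \<ge> 0" and "a * \<kappa> < 1"
  shows "(\<integral>g. complex_of_real (std_normal_density g) *
            exp (of_real (a / 2) * (of_real (sqrt \<kappa> * g) + \<i> * of_real t)\<^sup>2) \<partial>lborel) =
         of_real (exp (- (a / (1 - a * \<kappa>) * t\<^sup>2) / 2) / sqrt (1 - a * \<kappa>))"
proof -
  define s where "s = 1 / sqrt (1 - a * \<kappa>)"
  have s: "s > 0" using assms by (simp add: s_def)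
  have "complex_of_real (std_normal_density g) * exp (of_real (a / 2) * (of_real (sqrt \<kappa> * g) + \<i> * of_real t)\<^sup>2)
      = of_real (s * exp (- a * t\<^sup>2 / 2)) * (of_real (normal_density 0 s g) * iexp ((a * sqrt \<kappa> * t) * g))" for g
  proof -
    have "(complex_of_real (sqrt \<kappa> * g) + \<i> * of_real t)\<^sup>2 =
            of_real (\<kappa> * g\<^sup>2 - t\<^sup>2) + \<i> * of_real (2 * sqrt \<kappa> * g * t)"
      using assms(1) by (simp add: complex_eq_iff power2_eq_square algebra_simps)
    hence "of_real (a / 2) * (complex_of_real (sqrt \<kappa> * g) + \<i> * of_real t)\<^sup>2 =
            of_real (a * \<kappa> * g\<^sup>2 / 2) + of_real (- a * t\<^sup>2 / 2) + \<i> * of_real ((a * sqrt \<kappa> * t) * g)"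
      by (simp only:) (simp add: field_simps)
    hence "exp (of_real (a / 2) * (complex_of_real (sqrt \<kappa> * g) + \<i> * of_real t)\<^sup>2) =
        of_real (exp (a * \<kappa> * g\<^sup>2 / 2)) * of_real (exp (- a * t\<^sup>2 / 2)) * iexp ((a * sqrt \<kappa> * t) * g)"
      by (simp only: exp_add exp_of_real)
    hence "complex_of_real (std_normal_density g) * exp (of_real (a / 2) * (of_real (sqrt \<kappa> * g) + \<i> * of_real t)\<^sup>2) =
       of_real (std_normal_density g * exp (a * \<kappa> * g\<^sup>2 / 2)) * of_real (exp (- a * t\<^sup>2 / 2)) * iexp ((a * sqrt \<kappa> * t) * g)"
      by (simp only: of_real_mult mult_ac)
    also have "std_normal_density g * exp (a * \<kappa> * g\<^sup>2 / 2) = s * normal_density 0 s g"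
      unfolding s_def using std_normal_density_mult_exp_square[OF assms(2)] by simp
    finally show ?thesis by (simp only: of_real_mult mult_ac)
  qed
  hence "(\<integral>g. complex_of_real (std_normal_density g) *
            exp (of_real (a / 2) * (of_real (sqrt \<kappa> * g) + \<i> * of_real t)\<^sup>2) \<partial>lborel) =
         of_real (s * exp (- a * t\<^sup>2 / 2)) * of_real (exp (- (s\<^sup>2 * (a * sqrt \<kappa> * t)\<^sup>2) / 2))"
    by (simp only: integral_mult_right_zero integral_normal_density_iexp[OF s])
  also have "\<dots> = of_real (s * exp (- a * t\<^sup>2 / 2 + - (s\<^sup>2 * (a * sqrt \<kappa> * t)\<^sup>2) / 2))"
    by (simp only: exp_add of_real_mult mult.assoc)
  \<comment> \<open>The limiting variance arises here: a + a^2 \<kappa> / (1 - a \<kappa>) = a / (1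
    - a \<kappa>).\<close>
  also have "- a * t\<^sup>2 / 2 + - (s\<^sup>2 * (a * sqrt \<kappa> * t)\<^sup>2) / 2 = - (a / (1 - a * \<kappa>) * t\<^sup>2) / 2"
    using assms by (simp add: s_def power_divide power_mult_distrib) (simp add: field_simps power2_eq_square)
  finally show ?thesis by (simp add: s_def)
qed

text \<open>The Laplace transform of a standard Gaussian at sqrt \<kappa> * y is exp (\<kappa> y^2 /
  2); the phase does not depend on g and passes through as a constant.\<close>

lemma hubbard_stratonovich:
  fixes y :: real
  assumes "\<kappa> \<ge> 0"
  shows "has_bochner_integral lborel
           (\<lambda>g. complex_of_real (std_normal_density g) * exp ((of_real (sqrt \<kappa> * g) + \<i> * of_real t) * of_real y))
           (of_real (exp (\<kappa> * y\<^sup>2 / 2)) * iexp (t * y))"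
proof -
  have "has_bochner_integral lborel (\<lambda>g. complex_of_real (std_normal_density g * exp ((sqrt \<kappa> * y) * g)) * iexp (t * y))
           (of_real (exp ((sqrt \<kappa> * y)\<^sup>2 * 1\<^sup>2 / 2)) * iexp (t * y))"
    by (intro has_bochner_integral_mult_left has_bochner_integral_of_real
          has_bochner_integral_normal_density_mult_exp) simp
  moreover have "complex_of_real (std_normal_density g * exp ((sqrt \<kappa> * y) * g)) * iexp (t * y) =
      complex_of_real (std_normal_density g) * exp ((of_real (sqrt \<kappa> * g) + \<i> * of_real t) * of_real y)" for g
  proof -
    have "(of_real (sqrt \<kappa> * g) + \<i> * of_real t) * of_real y =
            complex_of_real ((sqrt \<kappa> * y) * g) + \<i> * complex_of_real (t * y)"
      by (simp add: algebra_simps)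
    thus ?thesis by (simp only: exp_add exp_of_real) (simp only: of_real_mult mult.assoc)
  qed
  moreover have "(sqrt \<kappa> * y)\<^sup>2 * 1\<^sup>2 / 2 = \<kappa> * y\<^sup>2 / 2" using assms by (simp add: power_mult_distrib)
  ultimately show ?thesis by (simp only:)
qed

section \<open>The Gibbs measure as a Gaussian mixture\<close>

text \<open>Without interaction the spins are independent, so the expectation of a product over
  sites factorizes.\<close>

lemma sum_configs_exp:
  fixes z :: complex
  shows "(\<Sum>\<sigma>\<in>configs n. of_real (\<Prod>i=1..n. site_prob T f x i (\<sigma> i)) * exp (z * of_real (magnetization n \<sigma>))) =
         (\<Prod>i=1..n. spin_mgf (f ((T ^^ i) x)) z)"
proof -
  have "(\<Prod>i=1..n. spin_mgf (f ((T ^^ i) x)) z) =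
        (\<Prod>i\<in>{1..n}. \<Sum>s\<in>{-1, 1::real}. of_real (site_prob T f x i s) * exp (z * of_real s))"
    by (intro prod.cong) (auto simp: spin_mgf_def site_prob_def)
  also have "\<dots> = (\<Sum>\<sigma>\<in>configs n. \<Prod>i\<in>{1..n}. of_real (site_prob T f x i (\<sigma> i)) * exp (z * of_real (\<sigma> i)))"
    unfolding configs_def by (rule prod_sum_PiE) auto
  also have "\<dots> = (\<Sum>\<sigma>\<in>configs n. of_real (\<Prod>i=1..n. site_prob T f x i (\<sigma> i)) * exp (z * of_real (magnetization n \<sigma>)))"
    by (simp add: prod.distrib magnetization_def sum_distrib_left exp_sum)
  finally show ?thesis ..
qed

lemma finite_configs [simp]: "finite (configs n)"
  unfolding configs_def by (intro finite_PiE) auto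

text \<open>The value at t = 0 is the partition function, so the characteristic function is a ratio
  of two values of this one sum and a single limit theorem serves numerator and denominator.\<close>

definition gibbs_char_sum ::
  "real \<Rightarrow> real \<Rightarrow> ('e \<Rightarrow> 'e) \<Rightarrow> ('e \<Rightarrow> real) \<Rightarrow> nat \<Rightarrow> 'e \<Rightarrow> real \<Rightarrow> complex" where
  "gibbs_char_sum \<beta> J T f n x t =
     (\<Sum>\<sigma>\<in>configs n. of_real (gibbs_weight \<beta> J T f n x \<sigma>) * iexp (t * (magnetization n \<sigma> / sqrt (real n))))"

lemma gibbs_char_sum_eq_integral:
  assumes "n > 0" and "\<beta> * J \<ge> 0"
  shows "gibbs_char_sum \<beta> J T f n x t = (\<integral>g. complex_of_real (std_normal_density g) *
           (\<Prod>i=1..n. spin_mgf (f ((T ^^ i) x))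
             ((of_real (sqrt (\<beta> * J) * g) + \<i> * of_real t) / of_real (sqrt (real n)))) \<partial>lborel)"
proof -
  let ?z = "\<lambda>g. of_real (sqrt (\<beta> * J) * g) + \<i> * complex_of_real t"
  let ?P = "\<lambda>\<sigma>. complex_of_real (\<Prod>i=1..n. site_prob T f x i (\<sigma> i))"
  let ?y = "\<lambda>\<sigma>. magnetization n \<sigma> / sqrt (real n)"
  have "has_bochner_integral lborel
     (\<lambda>g. \<Sum>\<sigma>\<in>configs n. ?P \<sigma> * (complex_of_real (std_normal_density g) * exp (?z g * of_real (?y \<sigma>))))
     (\<Sum>\<sigma>\<in>configs n. ?P \<sigma> * (of_real (exp (\<beta> * J * (?y \<sigma>)\<^sup>2 / 2)) * iexp (t * ?y \<sigma>)))"
    by (intro has_bochner_integral_sum has_bochner_integral_mult_right hubbard_stratonovich assms(2))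
  moreover have "(\<Sum>\<sigma>\<in>configs n. ?P \<sigma> * (of_real (exp (\<beta> * J * (?y \<sigma>)\<^sup>2 / 2)) * iexp (t * ?y \<sigma>))) =
                 gibbs_char_sum \<beta> J T f n x t"
    unfolding gibbs_char_sum_def
  proof (intro sum.cong refl)
    fix \<sigma> :: "nat \<Rightarrow> real"
    have "gibbs_weight \<beta> J T f n x \<sigma> = (\<Prod>i=1..n. site_prob T f x i (\<sigma> i)) * exp (\<beta> * J * (?y \<sigma>)\<^sup>2 / 2)"
      unfolding gibbs_weight_def magnetization_def using assms(1) by (simp add: power_divide mult_ac)
    thus "?P \<sigma> * (of_real (exp (\<beta> * J * (?y \<sigma>)\<^sup>2 / 2)) * iexp (t * ?y \<sigma>)) =
            of_real (gibbs_weight \<beta> J T f n x \<sigma>) * iexp (t * ?y \<sigma>)"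
      by (simp only: of_real_mult mult.assoc)
  qed
  moreover have "(\<Sum>\<sigma>\<in>configs n. ?P \<sigma> * (complex_of_real (std_normal_density g) * exp (?z g * of_real (?y \<sigma>)))) =
      complex_of_real (std_normal_density g) * (\<Prod>i=1..n. spin_mgf (f ((T ^^ i) x)) (?z g / of_real (sqrt (real n))))" for g
    unfolding sum_configs_exp[symmetric] sum_distrib_left by (intro sum.cong refl) (simp add: mult_ac)
  ultimately show ?thesis by (simp only: has_bochner_integral_integral_eq)
qed

text \<open>In modulus a generating function is largest on the real axis. There the drift costs at
  most exp |Re z| and the centred parts cost exp (\<rho> (Re z)^2), because n (Re z / sqrt n)^2 =
  (Re z)^2.\<close>

lemma spin_mgf_prod_bound:
  fixes z :: complex
  assumes p: "\<And>i. p i \<in> {0..1}" and n: "n > 0"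
    and le: "(\<Sum>i=1..n. ln_centred_mgf (p i) (Re z / sqrt (real n))) / real n \<le> \<rho> * (Re z / sqrt (real n))\<^sup>2"
    and drift: "\<bar>(\<Sum>i=1..n. 2 * p i - 1) / sqrt (real n)\<bar> \<le> 1"
  shows "norm (\<Prod>i=1..n. spin_mgf (p i) (z / of_real (sqrt (real n)))) \<le> exp \<bar>Re z\<bar> * exp (\<rho> * (Re z)\<^sup>2)"
proof -
  define u where "u = Re z / sqrt (real n)"
  have "norm (\<Prod>i=1..n. spin_mgf (p i) (z / of_real (sqrt (real n)))) \<le> (\<Prod>i=1..n. spin_mgf (p i) u)"
    unfolding prod_norm[symmetric] u_def
    using norm_spin_mgf_le[OF p, of _ "z / of_real (sqrt (real n))"] by (intro prod_mono) (simp add: Re_divide_of_real)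
  also have "\<dots> = (\<Prod>i=1..n. exp ((2 * p i - 1) * u + ln_centred_mgf (p i) u))"
    by (intro prod.cong refl) (simp add: spin_mgf_eq_centred exp_add exp_ln_centred_mgf[OF p])
  also have "\<dots> = exp ((\<Sum>i=1..n. 2 * p i - 1) * u + (\<Sum>i=1..n. ln_centred_mgf (p i) u))"
    by (simp add: exp_sum[symmetric] sum.distrib sum_distrib_right del: sum_subtractf)
  also have "\<dots> \<le> exp (\<bar>Re z\<bar> + \<rho> * (Re z)\<^sup>2)"
  proof -
    have "(\<Sum>i=1..n. 2 * p i - 1) * u = ((\<Sum>i=1..n. 2 * p i - 1) / sqrt (real n)) * Re z" by (simp add: u_def)
    also have "\<dots> \<le> \<bar>(\<Sum>i=1..n. 2 * p i - 1) / sqrt (real n)\<bar> * \<bar>Re z\<bar>" by (metis abs_ge_self abs_mult)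
    also have "\<dots> \<le> 1 * \<bar>Re z\<bar>" using drift by (intro mult_right_mono) auto
    finally have 1: "(\<Sum>i=1..n. 2 * p i - 1) * u \<le> \<bar>Re z\<bar>" by simp
    have "real n * u\<^sup>2 = (Re z)\<^sup>2" using n by (simp add: u_def power_divide)
    moreover have "(\<Sum>i=1..n. ln_centred_mgf (p i) u) \<le> \<rho> * u\<^sup>2 * real n"
      using le n unfolding u_def[symmetric] by (simp add: pos_divide_le_eq)
    ultimately have "(\<Sum>i=1..n. ln_centred_mgf (p i) u) \<le> \<rho> * (Re z)\<^sup>2" by (simp add: mult_ac)
    with 1 show ?thesis by simp
  qed
  finally show ?thesis by (simp add: exp_add)
qed

text \<open>The condition 2 \<rho> \<kappa> < 1 says that the Gaussian weight beats the growth exp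
  (\<rho> \<kappa> g^2) of the integrand. The frequency may depend on n, so that both scalings of
  the magnetization are covered.\<close>

lemma hs_integral_tendsto:
  assumes p: "\<And>i. p i \<in> {0..1}"
    and drift: "(\<lambda>n. (\<Sum>i=1..n. 2 * p i - 1) / sqrt (real n)) \<longlonglongrightarrow> 0"
    and var: "(\<lambda>n. (\<Sum>i=1..n. 4 * p i * (1 - p i)) / real n) \<longlonglongrightarrow> a"
    and le: "\<forall>\<^sub>F n in sequentially. \<forall>u. (\<Sum>i=1..n. ln_centred_mgf (p i) u) / real n \<le> \<rho> * u\<^sup>2"
    and \<kappa>: "\<kappa> \<ge> 0" "2 * \<rho> * \<kappa> < 1" and t: "t \<longlonglongrightarrow> \<tau>"
  shows "(\<lambda>n. \<integral>g. complex_of_real (std_normal_density g) *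
           (\<Prod>i=1..n. spin_mgf (p i) ((of_real (sqrt \<kappa> * g) + \<i> * of_real (t n)) / of_real (sqrt (real n)))) \<partial>lborel)
         \<longlonglongrightarrow> (\<integral>g. complex_of_real (std_normal_density g) *
            exp (of_real (a / 2) * (of_real (sqrt \<kappa> * g) + \<i> * of_real \<tau>)\<^sup>2) \<partial>lborel)"
proof -
  define z where "z n g = of_real (sqrt \<kappa> * g) + \<i> * complex_of_real (t n)" for n g
  define F where "F n g = complex_of_real (std_normal_density g) *
           (\<Prod>i=1..n. spin_mgf (p i) (z n g / of_real (sqrt (real n))))" for n g
  define s where "s = 1 / sqrt (1 - 2 * \<rho> * \<kappa>)"
  have s: "s > 0" using \<kappa> by (simp add: s_def)
  \<comment> \<open>The factor exp |x| from the drift is bounded by exp x + exp (-x), whose summands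
    are integrable by completing the square.\<close>
  define w where "w g = s * (normal_density 0 s g * exp (sqrt \<kappa> * g) + normal_density 0 s g * exp (- sqrt \<kappa> * g))" for g
  have Re_z: "Re (z n g) = sqrt \<kappa> * g" for n g by (simp add: z_def)
  have "\<forall>\<^sub>F n in sequentially. \<bar>(\<Sum>i=1..n. 2 * p i - 1) / sqrt (real n)\<bar> < 1"
    using tendsto_rabs_zero[OF drift] by (rule order_tendstoD) simp
  from eventually_conj[OF this eventually_conj[OF le eventually_gt_at_top[of 0]]]
  obtain N where N: "\<And>n. n \<ge> N \<Longrightarrow> \<bar>(\<Sum>i=1..n. 2 * p i - 1) / sqrt (real n)\<bar> < 1 \<and>
     (\<forall>u. (\<Sum>i=1..n. ln_centred_mgf (p i) u) / real n \<le> \<rho> * u\<^sup>2) \<and> n > 0"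
    unfolding eventually_sequentially by blast
  have bound: "norm (F n g) \<le> w g" if "n \<ge> N" for n g
  proof -
    have "norm (F n g) \<le> std_normal_density g * (exp \<bar>Re (z n g)\<bar> * exp (\<rho> * (Re (z n g))\<^sup>2))"
      unfolding F_def norm_mult norm_of_real using N[OF that]
      by (intro mult_mono spin_mgf_prod_bound p) auto
    also have "\<dots> = std_normal_density g * exp (2 * \<rho> * \<kappa> * g\<^sup>2 / 2) * exp \<bar>sqrt \<kappa> * g\<bar>"
      using \<kappa> by (simp add: Re_z power_mult_distrib mult_ac)
    also have "std_normal_density g * exp (2 * \<rho> * \<kappa> * g\<^sup>2 / 2) = s * normal_density 0 s g"
      unfolding s_def using std_normal_density_mult_exp_square[OF \<kappa>(2)] by simp
    also have "s * normal_density 0 s g * exp \<bar>sqrt \<kappa> * g\<bar> \<le>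
                 s * normal_density 0 s g * (exp (sqrt \<kappa> * g) + exp (- sqrt \<kappa> * g))"
      using s by (intro mult_left_mono) (auto simp: abs_if intro: less_imp_le add_increasing add_increasing2)
    also have "\<dots> = w g" by (simp add: w_def algebra_simps)
    finally show ?thesis .
  qed
  have lim: "(\<lambda>n. F n g) \<longlonglongrightarrow> complex_of_real (std_normal_density g) *
            exp (of_real (a / 2) * (of_real (sqrt \<kappa> * g) + \<i> * of_real \<tau>)\<^sup>2)" for g
  proof -
    let ?\<zeta> = "of_real (sqrt \<kappa> * g) + \<i> * complex_of_real \<tau>"
    have z: "(\<lambda>n. z n g) \<longlonglongrightarrow> ?\<zeta>" unfolding z_def by (intro tendsto_intros t)
    have "(\<Prod>i=1..n. spin_mgf (p i) (z n g / of_real (sqrt (real n)))) =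
          exp (of_real ((\<Sum>i=1..n. 2 * p i - 1) / sqrt (real n)) * z n g) *
          (\<Prod>i=1..n. centred_mgf (p i) (z n g / of_real (sqrt (real n))))" for n
      unfolding spin_mgf_eq_centred prod.distrib
      by (simp add: exp_sum[symmetric] sum_divide_distrib sum_distrib_right del: sum_subtractf)
    moreover have "(\<lambda>n. complex_of_real (std_normal_density g) *
        (exp (of_real ((\<Sum>i=1..n. 2 * p i - 1) / sqrt (real n)) * z n g) *
          (\<Prod>i=1..n. centred_mgf (p i) (z n g / of_real (sqrt (real n))))))
        \<longlonglongrightarrow> complex_of_real (std_normal_density g) * (exp (of_real 0 * ?\<zeta>) * exp (of_real (a / 2) * ?\<zeta>\<^sup>2))"
      by (intro tendsto_mult tendsto_const tendsto_exp tendsto_of_real drift z prod_centred_mgf_tendsto p var)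
    ultimately show ?thesis unfolding F_def by simp
  qed
  have meas: "F n \<in> borel_measurable borel" for n
  proof (rule borel_measurable_continuous_onI)
    have "continuous_on UNIV std_normal_density" unfolding normal_density_def by (intro continuous_intros) auto
    \<comment> \<open>The divisor sqrt n vanishes at n = 0, but there the product is empty.\<close>
    thus "continuous_on UNIV (F n)" unfolding F_def z_def
      by (cases "n = 0") (auto intro!: continuous_intros)
  qed
  \<comment> \<open>The bound by \<open>w\<close> holds from \<open>N\<close> on, so dominated
    convergence is applied to the shifted sequence.\<close>
  have "(\<lambda>n. integral\<^sup>L lborel (F (n + N))) \<longlonglongrightarrow> (\<integral>g. complex_of_real (std_normal_density g) *
            exp (of_real (a / 2) * (of_real (sqrt \<kappa> * g) + \<i> * of_real \<tau>)\<^sup>2) \<partial>lborel)"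
  proof (rule integral_dominated_convergence[where w = w])
    show "integrable lborel w" unfolding w_def
      using has_bochner_integral_normal_density_mult_exp[OF s, of "sqrt \<kappa>"]
        has_bochner_integral_normal_density_mult_exp[OF s, of "- sqrt \<kappa>"]
      by (intro integrable_mult_right Bochner_Integration.integrable_add) (auto simp: has_bochner_integral_iff)
    show "AE g in lborel. (\<lambda>n. F (n + N) g) \<longlonglongrightarrow> complex_of_real (std_normal_density g) *
            exp (of_real (a / 2) * (of_real (sqrt \<kappa> * g) + \<i> * of_real \<tau>)\<^sup>2)"
      by (intro AE_I2 LIMSEQ_ignore_initial_segment lim)
    show "AE g in lborel. norm (F (n + N) g) \<le> w g" for n
      by (intro AE_I2 bound) simp
    show "F (n + N) \<in> borel_measurable lborel" for n using meas by simp
  qed simp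
  from LIMSEQ_offset[OF this] show ?thesis by (simp only: F_def z_def)
qed

section \<open>Normalization and characteristic function of the Gibbs measure\<close>

lemma sum_prod_site_prob: "(\<Sum>\<sigma>\<in>configs n. \<Prod>i=1..n. site_prob T f x i (\<sigma> i)) = 1"
proof -
  have "(\<Sum>\<sigma>\<in>configs n. \<Prod>i=1..n. site_prob T f x i (\<sigma> i)) =
        (\<Prod>i\<in>{1..n}. \<Sum>s\<in>{-1, 1}. site_prob T f x i s)"
    unfolding configs_def by (rule prod_sum_PiE[symmetric]) auto
  thus ?thesis by (simp add: site_prob_def)
qed

lemma gibbs_weight_nonneg:
  assumes "\<And>y. f y \<in> {0..1}" shows "gibbs_weight \<beta> J T f n x \<sigma> \<ge> 0"
  unfolding gibbs_weight_def site_prob_def using assms by (intro mult_nonneg_nonneg prod_nonneg) auto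

lemma gibbs_partition_pos:
  assumes f: "\<And>y. f y \<in> {0..1}" and "\<beta> * J \<ge> 0"
  shows "(\<Sum>\<sigma>\<in>configs n. gibbs_weight \<beta> J T f n x \<sigma>) > 0"
proof -
  have "(\<Prod>i=1..n. site_prob T f x i (\<sigma> i)) \<le> gibbs_weight \<beta> J T f n x \<sigma>" for \<sigma>
  proof -
    have "0 \<le> (\<Prod>i=1..n. site_prob T f x i (\<sigma> i))"
      unfolding site_prob_def using f by (intro prod_nonneg) auto
    moreover have "1 \<le> exp (\<beta> * J / (2 * real n) * (\<Sum>i=1..n. \<sigma> i)\<^sup>2)"
      using assms(2) by simp
    ultimately show ?thesis unfolding gibbs_weight_def
      by (metis mult_1 mult_right_mono)
  qed
  hence "(\<Sum>\<sigma>\<in>configs n. \<Prod>i=1..n. site_prob T f x i (\<sigma> i)) \<le>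
           (\<Sum>\<sigma>\<in>configs n. gibbs_weight \<beta> J T f n x \<sigma>)" by (intro sum_mono)
  thus ?thesis unfolding sum_prod_site_prob by simp
qed

lemma real_distribution_gibbs:
  assumes f: "\<And>y. f y \<in> {0..1}" and J: "\<beta> * J \<ge> 0"
  shows "real_distribution (distr (gibbs_measure \<beta> J T f n x) borel X)"
proof -
  let ?Z = "\<Sum>\<tau>\<in>configs n. gibbs_weight \<beta> J T f n x \<tau>"
  have Z: "?Z > 0" by (rule gibbs_partition_pos[OF assms])
  have "(\<Sum>\<sigma>\<in>configs n. ennreal (gibbs_weight \<beta> J T f n x \<sigma> / ?Z)) =
          ennreal (\<Sum>\<sigma>\<in>configs n. gibbs_weight \<beta> J T f n x \<sigma> / ?Z)"
    using Z by (intro sum_ennreal divide_nonneg_nonneg gibbs_weight_nonneg f) auto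
  also have "(\<Sum>\<sigma>\<in>configs n. gibbs_weight \<beta> J T f n x \<sigma> / ?Z) = 1"
    unfolding sum_divide_distrib[symmetric] using Z by simp
  finally have "prob_space (gibbs_measure \<beta> J T f n x)"
    unfolding gibbs_measure_def
    by (intro prob_spaceI) (simp add: space_point_measure emeasure_point_measure_finite)
  thus ?thesis by (intro prob_space.real_distribution_distr) (auto simp: gibbs_measure_def)
qed

text \<open>The extra scale \<open>c\<close> treats both normalizations at once: c = 1 gives the
  central limit theorem, c = sqrt n the law of large numbers.\<close>

lemma char_gibbs_magnetization:
  assumes f: "\<And>y. f y \<in> {0..1}" and J: "\<beta> * J \<ge> 0" and n: "n > 0"
  shows "char (distr (gibbs_measure \<beta> J T f n x) borel (\<lambda>\<sigma>. magnetization n \<sigma> / (sqrt (real n) * c))) t =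
         gibbs_char_sum \<beta> J T f n x (t / c) / gibbs_char_sum \<beta> J T f n x 0"
proof -
  let ?Z = "\<Sum>\<tau>\<in>configs n. gibbs_weight \<beta> J T f n x \<tau>"
  have Z: "?Z > 0" by (rule gibbs_partition_pos[OF f J])
  have "char (distr (gibbs_measure \<beta> J T f n x) borel (\<lambda>\<sigma>. magnetization n \<sigma> / (sqrt (real n) * c))) t =
        (\<integral>\<sigma>. iexp (t * (magnetization n \<sigma> / (sqrt (real n) * c))) \<partial>gibbs_measure \<beta> J T f n x)"
    unfolding char_def by (rule integral_distr) (auto simp: gibbs_measure_def)
  also have "\<dots> = (\<Sum>\<sigma>\<in>configs n. (gibbs_weight \<beta> J T f n x \<sigma> / ?Z) *\<^sub>R iexp (t * (magnetization n \<sigma> / (sqrt (real n) * c))))"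
    unfolding gibbs_measure_def
    using Z by (intro lebesgue_integral_point_measure_finite divide_nonneg_nonneg gibbs_weight_nonneg f) auto
  also have "\<dots> = (\<Sum>\<sigma>\<in>configs n. of_real (gibbs_weight \<beta> J T f n x \<sigma>) *
      iexp ((t / c) * (magnetization n \<sigma> / sqrt (real n))) / of_real ?Z)"
    by (intro sum.cong refl) (simp add: scaleR_conv_of_real mult_ac)
  also have "\<dots> = gibbs_char_sum \<beta> J T f n x (t / c) / of_real ?Z"
    unfolding gibbs_char_sum_def sum_divide_distrib ..
  also have "of_real ?Z = gibbs_char_sum \<beta> J T f n x 0" by (simp add: gibbs_char_sum_def)
  finally show ?thesis .
qed

section \<open>The critical temperature\<close>

text \<open>Mean 1/2 makes the spins centred on average, so the linear terms split off by centring
  integrate to 0.\<close>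

lemma free_energy_G_eq:
  assumes M: "prob_space \<mu>" and f: "f \<in> borel_measurable \<mu>" "\<And>y. f y \<in> {0..1}" and mean: "(\<integral>y. f y \<partial>\<mu>) = 1/2"
  shows "free_energy_G J \<mu> f \<beta> s = \<beta> * J / 2 * s\<^sup>2 - (\<integral>y. ln_centred_mgf (f y) (\<beta> * J * s) \<partial>\<mu>)"
proof -
  interpret prob_space \<mu> by fact
  note [measurable] = f(1)
  let ?u = "\<beta> * J * s"
  have f01: "0 \<le> f y" "f y \<le> 1" for y using f(2)[of y] by auto
  have fi: "integrable \<mu> f" by (rule integrable_const_bound[of _ 1]) (auto simp: f01)
  have int: "integrable \<mu> (\<lambda>y. ln_centred_mgf (f y) ?u)"
    by (rule integrable_ln_centred_mgf[OF M f])
  have "(\<integral>y. ln (f y * exp ?u + (1 - f y) * exp (- ?u)) \<partial>\<mu>) =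
        (\<integral>y. (2 * f y - 1) * ?u + ln_centred_mgf (f y) ?u \<partial>\<mu>)"
    using ln_spin_mgf[OF f(2), of _ ?u] by (simp add: spin_mgf_def)
  also have "\<dots> = (\<integral>y. (2 * f y - 1) * ?u \<partial>\<mu>) + (\<integral>y. ln_centred_mgf (f y) ?u \<partial>\<mu>)"
    by (intro Bochner_Integration.integral_add int integrable_mult_left Bochner_Integration.integrable_diff
          integrable_mult_right fi integrable_const)
  also have "(\<integral>y. (2 * f y - 1) * ?u \<partial>\<mu>) = (2 * (\<integral>y. f y \<partial>\<mu>) - 1) * ?u"
    by (simp only: integral_mult_left_zero integral_mult_right_zero Bochner_Integration.integral_diff[OF integrable_mult_right[OF fi] integrable_const]
          lebesgue_integral_const prob_space scaleR_one)
  finally show ?thesis unfolding free_energy_G_def using mean by simp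
qed

text \<open>The substitution u = \<beta> J s removes \<beta> from the integral and leaves it only in
  the coefficient, where the condition visibly gets stronger as \<beta> grows.\<close>

lemma free_energy_G_nonneg_iff:
  assumes M: "prob_space \<mu>" and f: "f \<in> borel_measurable \<mu>" "\<And>y. f y \<in> {0..1}" and mean: "(\<integral>y. f y \<partial>\<mu>) = 1/2"
    and pos: "\<beta> > 0" "J > 0"
  shows "(\<forall>s. free_energy_G J \<mu> f \<beta> s \<ge> 0) \<longleftrightarrow>
         (\<forall>u. (\<integral>y. ln_centred_mgf (f y) u \<partial>\<mu>) \<le> 1 / (2 * (\<beta> * J)) * u\<^sup>2)"
proof -
  have *: "free_energy_G J \<mu> f \<beta> s \<ge> 0 \<longleftrightarrow>
      (\<integral>y. ln_centred_mgf (f y) (\<beta> * J * s) \<partial>\<mu>) \<le> 1 / (2 * (\<beta> * J)) * (\<beta> * J * s)\<^sup>2" for s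
  proof -
    have "1 / (2 * (\<beta> * J)) * (\<beta> * J * s)\<^sup>2 = \<beta> * J / 2 * s\<^sup>2"
      using pos by (simp add: power2_eq_square field_simps)
    thus ?thesis unfolding free_energy_G_eq[OF M f mean] by linarith
  qed
  show ?thesis
  proof (intro iffI allI)
    fix u assume "\<forall>s. free_energy_G J \<mu> f \<beta> s \<ge> 0"
    hence "free_energy_G J \<mu> f \<beta> (u / (\<beta> * J)) \<ge> 0" ..
    thus "(\<integral>y. ln_centred_mgf (f y) u \<partial>\<mu>) \<le> 1 / (2 * (\<beta> * J)) * u\<^sup>2"
      unfolding * using pos by simp
  next
    fix s assume "\<forall>u. (\<integral>y. ln_centred_mgf (f y) u \<partial>\<mu>) \<le> 1 / (2 * (\<beta> * J)) * u\<^sup>2"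
    thus "free_energy_G J \<mu> f \<beta> s \<ge> 0" unfolding * by blast
  qed
qed

text \<open>Taylor's estimate for |u| <= 1, and 2 |u| <= 2 u^2 beyond. The crude constant is enough
  to exhibit one admissible inverse temperature, so that the set defining \<open>beta_c\<close> is
  nonempty.\<close>

lemma ln_centred_mgf_quadratic:
  obtains C where "C > 0" "\<And>p u. p \<in> {0..1} \<Longrightarrow> ln_centred_mgf p u \<le> C * u\<^sup>2"
proof -
  obtain C where C: "C \<ge> 0"
    "\<And>p u. p \<in> {0..1} \<Longrightarrow> \<bar>u\<bar> \<le> 1 \<Longrightarrow> \<bar>ln_centred_mgf p u - 2 * p * (1 - p) * u\<^sup>2\<bar> \<le> C * \<bar>u\<bar> ^ 3"
    by (rule ln_centred_mgf_taylor) (rule that)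
  have "ln_centred_mgf p u \<le> (C + 2) * u\<^sup>2" if p: "p \<in> {0..1}" for p u
  proof (cases "\<bar>u\<bar> \<le> 1")
    case True
    have "\<bar>u\<bar> ^ 3 \<le> u\<^sup>2" using power_decreasing[of 2 3 "\<bar>u\<bar>"] True by simp
    hence "C * \<bar>u\<bar> ^ 3 \<le> C * u\<^sup>2" using C(1) by (intro mult_left_mono)
    moreover have "2 * p * (1 - p) * u\<^sup>2 \<le> 2 * u\<^sup>2"
      using p by (intro mult_right_mono) (auto simp: mult_le_one)
    ultimately show ?thesis using C(2)[OF p True] by (simp add: distrib_right)
  next
    case False
    hence "\<bar>u\<bar> \<le> \<bar>u\<bar>\<^sup>2" by (intro self_le_power) auto
    hence "2 * \<bar>u\<bar> \<le> 2 * u\<^sup>2" by simp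
    also have "\<dots> \<le> (C + 2) * u\<^sup>2" using C(1) by (intro mult_right_mono) auto
    finally show ?thesis using ln_centred_mgf_le[OF p, of u] by linarith
  qed
  with C(1) show ?thesis using that[of "C + 2"] by simp
qed

text \<open>Below the supremum lies an admissible \<beta>' > \<beta>; the witness is \<kappa> =
  \<beta>' J. The strict gap above \<beta> J is what the domination consumes.\<close>

lemma less_beta_cE:
  assumes M: "prob_space \<mu>" and f: "f \<in> borel_measurable \<mu>" "\<And>y. f y \<in> {0..1}" and mean: "(\<integral>y. f y \<partial>\<mu>) = 1/2"
    and J: "J > 0" and \<beta>: "0 < \<beta>" "\<beta> < beta_c J \<mu> f"
  obtains \<kappa> where "\<beta> * J < \<kappa>" "\<And>u. (\<integral>y. ln_centred_mgf (f y) u \<partial>\<mu>) \<le> 1 / (2 * \<kappa>) * u\<^sup>2"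
proof -
  interpret prob_space \<mu> by fact
  obtain C where C: "C > 0" "\<And>p u. p \<in> {0..1} \<Longrightarrow> ln_centred_mgf p u \<le> C * u\<^sup>2"
    by (rule ln_centred_mgf_quadratic) (rule that)
  define \<beta>0 where "\<beta>0 = 1 / (2 * C * J)"
  have \<beta>0: "\<beta>0 > 0" "1 / (2 * (\<beta>0 * J)) = C" using C(1) J by (auto simp: \<beta>0_def)
  have "(\<integral>y. ln_centred_mgf (f y) u \<partial>\<mu>) \<le> C * u\<^sup>2" for u
    using integral_mono[OF integrable_ln_centred_mgf[OF M f, of u] integrable_const[of "C * u\<^sup>2"] C(2)[OF f(2)]]
    by (simp add: prob_space)
  hence "\<forall>s. free_energy_G J \<mu> f \<beta>0 s \<ge> 0"
    unfolding free_energy_G_nonneg_iff[OF M f mean \<beta>0(1) J] \<beta>0(2) ..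
  hence "{\<beta>. \<beta> > 0 \<and> (\<forall>s. free_energy_G J \<mu> f \<beta> s \<ge> 0)} \<noteq> {}" using \<beta>0(1) by blast
  from less_cSupD[OF this \<beta>(2)[unfolded beta_c_def]]
  obtain \<beta>' where \<beta>': "\<beta> < \<beta>'" "0 < \<beta>'" "\<forall>s. free_energy_G J \<mu> f \<beta>' s \<ge> 0" by blast
  show ?thesis
  proof (rule that[of "\<beta>' * J"])
    show "\<beta> * J < \<beta>' * J" using \<beta>' J by simp
    show "(\<integral>y. ln_centred_mgf (f y) u \<partial>\<mu>) \<le> 1 / (2 * (\<beta>' * J)) * u\<^sup>2" for u
      using \<beta>'(3) unfolding free_energy_G_nonneg_iff[OF M f mean \<beta>'(2) J] by blast
  qed
qed

section \<open>The law of large numbers and the central limit theorem\<close>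

theorem theorem4p1:
  fixes T :: "'e::metric_space \<Rightarrow> 'e" and \<mu> :: "'e measure" and f :: "'e \<Rightarrow> real"
    and x :: 'e and J a \<beta> :: real
  assumes "compact (UNIV :: 'e set)"
    and "continuous_on UNIV T"
    and "uniquely_ergodic T \<mu>"
    and "continuous_on UNIV f"
    and "\<forall>y. f y \<in> {0..1}"
    and "(\<integral>y. f y \<partial>\<mu>) = 1/2"
    and "a = (\<integral>y. 4 * f y * (1 - f y) \<partial>\<mu>)"
    and "a > 0"
    and "J > 0"
    and "f \<in> C_half T \<mu>"
    and "0 < \<beta>" and "\<beta> < beta_c J \<mu> f"
  shows "weak_conv_m
           (\<lambda>n. distr (gibbs_measure \<beta> J T f n x) borel (\<lambda>\<sigma>. magnetization n \<sigma> / real n))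
           (return borel 0)
       \<and> weak_conv_m
           (\<lambda>n. distr (gibbs_measure \<beta> J T f n x) borel (\<lambda>\<sigma>. magnetization n \<sigma> / sqrt (real n)))
           (normal_law 0 (a / (1 - \<beta> * J * a)))"
proof -
  have f01: "f y \<in> {0..1}" for y using assms(5) by blast
  have \<mu>: "prob_space \<mu>" "sets \<mu> = sets borel"
    using assms(3) by (auto simp: uniquely_ergodic_def invariant_prob_def)
  have fm: "f \<in> borel_measurable \<mu>"
    unfolding measurable_cong_sets[OF \<mu>(2) refl] using assms(4) by (rule borel_measurable_continuous_onI)
  define \<kappa> where "\<kappa> = \<beta> * J"
  have \<kappa>: "\<kappa> > 0" using assms by (simp add: \<kappa>_def)
  obtain \<kappa>' where \<kappa>': "\<kappa> < \<kappa>'" and \<Lambda>: "\<And>u. (\<integral>y. ln_centred_mgf (f y) u \<partial>\<mu>) \<le> 1 / (2 * \<kappa>') * u\<^sup>2"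
    using less_beta_cE[OF \<mu>(1) fm f01 assms(6,9,11,12)] unfolding \<kappa>_def by blast
  have a_le: "a / 2 \<le> 1 / (2 * \<kappa>')"
    unfolding assms(7) by (rule integral_variance_le[OF \<mu>(1) fm f01 \<Lambda>])
  have a\<kappa>: "a * \<kappa> < 1"
  proof -
    have "a * \<kappa>' \<le> 1" using a_le \<kappa> \<kappa>' by (simp add: field_simps)
    moreover have "a * \<kappa> < a * \<kappa>'" using \<kappa>' assms(8) by simp
    ultimately show ?thesis by linarith
  qed
  \<comment> \<open>Any value strictly between 1 / (2 \<kappa>') and 1 / (2 \<kappa>) would do: the
    lower bound gives slack for the orbit averages, the upper one integrability.\<close>
  define \<rho> where "\<rho> = 1 / (\<kappa> + \<kappa>')"
  have \<rho>: "1 / (2 * \<kappa>') < \<rho>" "2 * \<rho> * \<kappa> < 1"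
    using \<kappa> \<kappa>' by (auto simp: \<rho>_def field_simps)
  define p where "p i = f ((T ^^ i) x)" for i
  have p: "p i \<in> {0..1}" for i by (simp only: p_def f01)
  have drift: "(\<lambda>n. (\<Sum>i=1..n. 2 * p i - 1) / sqrt (real n)) \<longlonglongrightarrow> 0"
  proof -
    have "(\<lambda>n. \<bar>\<Sum>k=1..n. f ((T ^^ k) x) - 1 / 2\<bar>) \<in> o(\<lambda>n. sqrt (real n))"
      using assms(10) unfolding C_half_def mem_Collect_eq assms(6) by (rule spec)
    hence "(\<lambda>n. \<bar>\<Sum>k=1..n. f ((T ^^ k) x) - 1 / 2\<bar> / sqrt (real n)) \<longlonglongrightarrow> 0"
      by (rule smalloD_tendsto)
    hence "(\<lambda>n. 2 * (\<bar>\<Sum>k=1..n. f ((T ^^ k) x) - 1 / 2\<bar> / sqrt (real n))) \<longlonglongrightarrow> 0"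
      by (rule tendsto_mult_right_zero)
    moreover have "\<bar>(\<Sum>i=1..n. 2 * p i - 1) / sqrt (real n)\<bar> =
        2 * (\<bar>\<Sum>k=1..n. f ((T ^^ k) x) - 1 / 2\<bar> / sqrt (real n))" for n
    proof -
      have "(\<Sum>i=1..n. 2 * p i - 1) = 2 * (\<Sum>k=1..n. f ((T ^^ k) x) - 1 / 2)"
        unfolding sum_distrib_left by (intro sum.cong refl) (simp add: p_def)
      thus ?thesis by (simp only: abs_divide abs_mult) simp
    qed
    ultimately have "(\<lambda>n. \<bar>(\<Sum>i=1..n. 2 * p i - 1) / sqrt (real n)\<bar>) \<longlonglongrightarrow> 0" by (simp only:)
    thus ?thesis by (rule tendsto_rabs_zero_cancel)
  qed
  have var: "(\<lambda>n. (\<Sum>i=1..n. 4 * p i * (1 - p i)) / real n) \<longlonglongrightarrow> a"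
    unfolding assms(7) p_def by (rule uniquely_ergodic_average[OF assms(1-3)]) (intro continuous_intros assms(4))
  have H: "(\<lambda>n. (\<Sum>i=1..n. ln_centred_mgf (p i) u) / real n) \<longlonglongrightarrow> (\<integral>y. ln_centred_mgf (f y) u \<partial>\<mu>)" for u
    unfolding p_def
  proof (rule uniquely_ergodic_average[OF assms(1-3)])
    have "centred_mgf (f y) u \<noteq> 0" for y using centred_mgf_pos[OF f01, of y u] by simp
    thus "continuous_on UNIV (\<lambda>y. ln_centred_mgf (f y) u)"
      unfolding ln_centred_mgf_def centred_mgf_def of_real_eq_id id_apply
      by (intro continuous_intros assms(4)) auto
  qed
  have le: "\<forall>\<^sub>F n in sequentially. \<forall>u. (\<Sum>i=1..n. ln_centred_mgf (p i) u) / real n \<le> \<rho> * u\<^sup>2"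
    by (rule eventually_average_ln_centred_mgf_le[OF p H var \<Lambda> a_le _ \<rho>(1)]) (use \<kappa> \<kappa>' in simp)
  define v where "v = a / (1 - a * \<kappa>)"
  have v: "v > 0" using a\<kappa> assms(8) by (simp add: v_def)
  \<comment> \<open>The limit of the partition functions; it cancels in the quotient below.\<close>
  define b where "b = 1 / sqrt (1 - a * \<kappa>)"
  have b: "b \<noteq> 0" using a\<kappa> by (simp add: b_def)
  have conv: "(\<lambda>n. gibbs_char_sum \<beta> J T f n x (t n)) \<longlonglongrightarrow> of_real (exp (- (v * \<tau>\<^sup>2) / 2) * b)"
    if "t \<longlonglongrightarrow> \<tau>" for t \<tau>
  proof -
    have "\<forall>\<^sub>F n in sequentially. (\<integral>g. complex_of_real (std_normal_density g) *
           (\<Prod>i=1..n. spin_mgf (p i) ((of_real (sqrt \<kappa> * g) + \<i> * of_real (t n)) / of_real (sqrt (real n)))) \<partial>lborel)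
           = gibbs_char_sum \<beta> J T f n x (t n)"
      using eventually_gt_at_top[of 0]
    proof eventually_elim
      case (elim n)
      show ?case unfolding p_def \<kappa>_def
        by (rule gibbs_char_sum_eq_integral[OF elim less_imp_le[OF \<kappa>[unfolded \<kappa>_def]], symmetric])
    qed
    with hs_integral_tendsto[OF p drift var le less_imp_le[OF \<kappa>] \<rho>(2) that]
    have "(\<lambda>n. gibbs_char_sum \<beta> J T f n x (t n)) \<longlonglongrightarrow> (\<integral>g. complex_of_real (std_normal_density g) *
            exp (of_real (a / 2) * (of_real (sqrt \<kappa> * g) + \<i> * of_real \<tau>)\<^sup>2) \<partial>lborel)"
      by (rule Lim_transform_eventually)
    thus ?thesis
      unfolding integral_gaussian_exp_square[OF less_imp_le[OF \<kappa>] a\<kappa>] by (simp add: v_def b_def)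
  qed
  have char_conv: "(\<lambda>n. char (distr (gibbs_measure \<beta> J T f n x) borel
        (\<lambda>\<sigma>. magnetization n \<sigma> / (sqrt (real n) * c n))) t) \<longlonglongrightarrow> of_real (exp (- (v * \<tau>\<^sup>2) / 2))"
    if "(\<lambda>n. t / c n) \<longlonglongrightarrow> \<tau>" for c :: "nat \<Rightarrow> real" and t \<tau>
  proof -
    have lim: "(\<lambda>n. gibbs_char_sum \<beta> J T f n x (t / c n) / gibbs_char_sum \<beta> J T f n x 0) \<longlonglongrightarrow>
        of_real (exp (- (v * \<tau>\<^sup>2) / 2) * b) / of_real (exp (- (v * 0\<^sup>2) / 2) * b)"
      by (intro tendsto_divide conv that tendsto_const) (use b in simp)
    have eq: "complex_of_real (exp (- (v * \<tau>\<^sup>2) / 2) * b) / of_real (exp (- (v * 0\<^sup>2) / 2) * b) =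
        of_real (exp (- (v * \<tau>\<^sup>2) / 2))" using b by simp
    have "\<forall>\<^sub>F n in sequentially. gibbs_char_sum \<beta> J T f n x (t / c n) / gibbs_char_sum \<beta> J T f n x 0 =
        char (distr (gibbs_measure \<beta> J T f n x) borel (\<lambda>\<sigma>. magnetization n \<sigma> / (sqrt (real n) * c n))) t"
      using eventually_gt_at_top[of 0]
      by eventually_elim (rule char_gibbs_magnetization[OF f01, symmetric], use \<kappa> in \<open>simp_all add: \<kappa>_def\<close>)
    from Lim_transform_eventually[OF lim this] show ?thesis unfolding eq .
  qed
  have rd: "real_distribution (distr (gibbs_measure \<beta> J T f n x) borel X)" for n X
    using \<kappa> by (intro real_distribution_gibbs f01) (simp add: \<kappa>_def)
  show ?thesis
  proof
    have "real_distribution (return borel (0::real))"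
      by (simp add: real_distribution_def real_distribution_axioms_def prob_space_return)
    \<comment> \<open>The constant 1 is written as the Gaussian limit at frequency 0, to match
      \<open>char_conv\<close> with \<tau> = 0: dividing by n amounts to the frequency t / sqrt
      n.\<close>
    moreover have "char (return borel 0) t = of_real (exp (- (v * 0\<^sup>2) / 2))" for t
      unfolding char_def by (subst integral_return) auto
    moreover have "(\<lambda>n. t / sqrt (real n)) \<longlonglongrightarrow> 0" for t
      by (intro tendsto_divide_0[OF tendsto_const] filterlim_at_top_imp_at_infinity
            filterlim_compose[OF sqrt_at_top filterlim_real_sequentially])
    ultimately show "weak_conv_m (\<lambda>n. distr (gibbs_measure \<beta> J T f n x) borel (\<lambda>\<sigma>. magnetization n \<sigma> / real n))
       (return borel 0)"
      using char_conv[of _ "\<lambda>n. sqrt (real n)" 0] by (intro levy_continuity rd) simp_all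
    have "a / (1 - \<beta> * J * a) = v" by (simp add: v_def \<kappa>_def mult_ac)
    moreover have "weak_conv_m (\<lambda>n. distr (gibbs_measure \<beta> J T f n x) borel (\<lambda>\<sigma>. magnetization n \<sigma> / sqrt (real n)))
       (normal_law 0 v)"
      using char_conv[of _ "\<lambda>_. 1"] char_normal_law[OF v]
      by (intro levy_continuity rd real_distribution_normal_law v) simp_all
    ultimately show "weak_conv_m (\<lambda>n. distr (gibbs_measure \<beta> J T f n x) borel (\<lambda>\<sigma>. magnetization n \<sigma> / sqrt (real n)))
       (normal_law 0 (a / (1 - \<beta> * J * a)))" by simp
  qed
qed

end
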